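(* The lattice $\mathscr{L}_{\mathbb Z}$ is a proper class. More precisely, for every fixed prime $p$, the relations $\{\leq^{p^\theta}_{\mathrm{iso}}\mid\theta\in\mathrm{Card}\}$ form a strictly increasing proper-class-sized chain in $\mathscr{L}_{\mathbb Z}$.
   Context: $\mathbb Z\text{-}\mathrm{Mod}$ is the class of all abelian groups, viewed as structures in the language of $\mathbb Z$-modules. $A\leq B$ means subgroup, $A\leq_\oplus B$ means direct summand. $\mathrm{Card}$ is the class of cardinals. AEC: a pair $\mathcal K=(\mathbf K,\preccurlyeq)$, with $\mathbf K$ a class of $L$-structures and $\preccurlyeq$ a binary relation on $\mathbf K$, such that: (i) $\mathbf K$ and $\preccurlyeq$ are closed under isomorphisms; (ii) $A\preccurlyeq B$ implies $A$ is a substructure of $B$; (iii) $\preccurlyeq$ is a partial order; (iv) if $(A_i)_{i<\delta}$ ($\delta$ limit) is an increasing continuous $\preccurlyeq$-chain in $\mathbf K$, then $A=\bigcup_{i<\delta}A_i\in\mathbf K$, $A_j\preccurlyeq A$ for all $j<\delta$, and if $A_i\preccurlyeq B$ for all $i<\delta$ then $A\preccurlyeq B$; (v) if $A\preccurlyeq C$, $B\preccurlyeq C$ and $A$ is a substructure of $B$ then $A\preccurlyeq B$; (vi) there is a cardinal $\lambda\geq|L|+\aleph_0$ such that for all $B\in\mathbf K$, $X\subseteq B$ there is $A\in\mathbf K$ with $X\subseteq A\preccurlyeq B$ and $|A|\leq|X|+\lambda$. $\mathscr{L}_{\mathbb Z}$ is the class of all binary relations $\preccurlyeq$ on $\mathbb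 Z\text{-}\mathrm{Mod}$ such that $(\mathbb Z\text{-}\mathrm{Mod},\preccurlyeq)$ is an AEC and $A\leq_\oplus B$ implies $A\preccurlyeq B$. It is ordered by reverse inclusion (stronger relations are higher). For an abelian group $A$, a prime $p$ and an ordinal $\alpha$: $p^0A=A$, $p^{\beta+1}A=p(p^\beta A)$, and $p^\alpha A=\bigcap_{\beta<\alpha}p^\beta A$ for $\alpha$ limit. $A\leq^{p^\alpha}_{\mathrm{iso}}B$ ($A$ is $p^\alpha$-isotype in $B$) iff $A\leq B$ and $p^\beta B\cap A=p^\beta A$ for every ordinal $\beta\leq\alpha$. In $\leq^{p^\theta}_{\mathrm{iso}}$ the cardinal $\theta$ is regarded as an ordinal. *)

theory Defs
  imports "HOL-Algebra.Coset" "HOL-Computational_Algebra.Primes"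
begin

unbundle cardinal_syntax

text \<open>
  The set-theoretic universe. A type \<open>'v\<close> together with the map \<open>elts\<close> that sends a set to the
  class of its elements is required to satisfy the axioms of ZFC. Classes are the HOL sets over
  \<open>'v\<close>; a class is a set iff it lies in \<open>range elts\<close>. Pairing follows from power set and
  replacement, choice comes from the choice operator of HOL.
\<close>

locale zfc_universe =
  fixes elts :: "'v \<Rightarrow> 'v set"
  assumes extensionality: "elts x = elts y \<Longrightarrow> x = y"
    and foundation: "wf {(x, y). x \<in> elts y}"
    and separation: "X \<subseteq> elts x \<Longrightarrow> X \<in> range elts"
    and union: "(\<Union>y \<in> elts x. elts y) \<in> range elts"
    and power: "{y. elts y \<subseteq> elts x} \<in> range elts"
    and replacement: "f ` elts x \<in> range elts"
    and infinity: "\<exists>x. (\<exists>z \<in> elts x. elts z = {}) \<and>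
                       (\<forall>y \<in> elts x. \<exists>z \<in> elts x. elts z = insert y (elts y))"
begin

text \<open>
  The notion of being a proper class is needed for collections of classes (such as a family of
  binary relations on a proper class), whose members are not elements of the universe. It is
  therefore expressed through size.
\<close>

definition set_sized :: "'b set \<Rightarrow> bool" where
  "set_sized X \<longleftrightarrow> (\<exists>x. |X| \<le>o |elts x| )"

abbreviation proper_class_sized :: "'b set \<Rightarrow> bool" where
  "proper_class_sized X \<equiv> \<not> set_sized X"


subsection \<open>Von Neumann ordinals and cardinals\<close>

definition transitive_set :: "'v \<Rightarrow> bool" where
  "transitive_set x \<longleftrightarrow> (\<forall>y \<in> elts x. elts y \<subseteq> elts x)"

definition Ord :: "'v \<Rightarrow> bool" where
  "Ord \<alpha> \<longleftrightarrow> transitive_set \<alpha> \<and> (\<forall>\<beta> \<in> elts \<alpha>. transitive_set \<beta>)"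

definition is_succ_of :: "'v \<Rightarrow> 'v \<Rightarrow> bool" where
  "is_succ_of \<alpha> \<beta> \<longleftrightarrow> elts \<alpha> = insert \<beta> (elts \<beta>)"

definition Limit :: "'v \<Rightarrow> bool" where
  "Limit \<alpha> \<longleftrightarrow> Ord \<alpha> \<and> elts \<alpha> \<noteq> {} \<and> \<not> (\<exists>\<beta>. is_succ_of \<alpha> \<beta>)"

definition Card :: "'v set" where
  "Card = {\<theta>. Ord \<theta> \<and> (\<forall>\<alpha> \<in> elts \<theta>. |elts \<alpha>| <o |elts \<theta>| )}"


subsection \<open>The class of all abelian groups\<close>

text \<open>
  Abelian groups are written multiplicatively. The operation is required to be undefined outside
  the carrier, so that two groups with the same carrier and the same operation on it are equal.
\<close>

definition ab_groups :: "'v monoid set" where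
  "ab_groups = {A. comm_group A \<and> carrier A \<in> range elts \<and>
                   (\<lambda>(x, y). x \<otimes>\<^bsub>A\<^esub> y) \<in> extensional (carrier A \<times> carrier A)}"

text \<open>For abelian groups, the substructures in the language of modules over the integers.\<close>

definition is_subgroup :: "'v monoid \<Rightarrow> 'v monoid \<Rightarrow> bool" where
  "is_subgroup A B \<longleftrightarrow> subgroup (carrier A) B \<and> \<one>\<^bsub>A\<^esub> = \<one>\<^bsub>B\<^esub> \<and>
     (\<forall>x \<in> carrier A. \<forall>y \<in> carrier A. x \<otimes>\<^bsub>A\<^esub> y = x \<otimes>\<^bsub>B\<^esub> y)"

definition is_direct_summand :: "'v monoid \<Rightarrow> 'v monoid \<Rightarrow> bool" where
  "is_direct_summand A B \<longleftrightarrow> is_subgroup A B \<and>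
     (\<exists>C. subgroup C B \<and> carrier A \<inter> C = {\<one>\<^bsub>B\<^esub>} \<and> carrier A <#>\<^bsub>B\<^esub> C = carrier B)"

text \<open>The union of a nonempty family of groups that is directed under the subgroup relation.\<close>

definition union_group :: "'i set \<Rightarrow> ('i \<Rightarrow> 'v monoid) \<Rightarrow> 'v monoid" where
  "union_group I A =
     \<lparr>carrier = (\<Union>i \<in> I. carrier (A i)),
      monoid.mult = (\<lambda>x y. if \<exists>i \<in> I. x \<in> carrier (A i) \<and> y \<in> carrier (A i)
                    then monoid.mult (A (SOME i. i \<in> I \<and> x \<in> carrier (A i) \<and> y \<in> carrier (A i))) x y
                    else undefined),
      one = one (A (SOME i. i \<in> I))\<rparr>"


subsection \<open>Abstract elementary classes of abelian groups\<close>

definition continuous_chain ::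
    "'v monoid set \<Rightarrow> 'v monoid rel \<Rightarrow> 'v \<Rightarrow> ('v \<Rightarrow> 'v monoid) \<Rightarrow> bool" where
  "continuous_chain K R \<delta> A \<longleftrightarrow>
     (\<forall>i \<in> elts \<delta>. A i \<in> K) \<and>
     (\<forall>j \<in> elts \<delta>. \<forall>i \<in> elts j. (A i, A j) \<in> R) \<and>
     (\<forall>j \<in> elts \<delta>. Limit j \<longrightarrow> A j = union_group (elts j) A)"

text \<open>
  The pair \<open>(K, R)\<close> is an AEC in the language of modules over the integers, all of whose members
  are abelian groups. As this language is countably infinite, the condition on the
  Loewenheim-Skolem cardinal \<open>\<kappa>\<close> to be at least the size of the language plus aleph-zero says
  that \<open>\<kappa>\<close> is at least aleph-zero. In the closure of \<open>R\<close> under isomorphisms, \<open>f \<in> iso B B'\<close>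
  and \<open>f \<in> iso A A'\<close> force \<open>A'\<close> to be the subgroup of \<open>B'\<close> with carrier \<open>f ` carrier A\<close>.
\<close>

definition AEC :: "'v monoid set \<Rightarrow> 'v monoid rel \<Rightarrow> bool" where
  "AEC K R \<longleftrightarrow>
     K \<subseteq> ab_groups \<and> R \<subseteq> K \<times> K \<and>
     \<comment> \<open>closure under isomorphisms\<close>
     (\<forall>A \<in> K. \<forall>A' \<in> ab_groups. iso A A' \<noteq> {} \<longrightarrow> A' \<in> K) \<and>
     (\<forall>A B. \<forall>A' \<in> ab_groups. \<forall>B' \<in> ab_groups. \<forall>f.
        (A, B) \<in> R \<and> f \<in> iso B B' \<and> f \<in> iso A A' \<longrightarrow> (A', B') \<in> R) \<and>
     \<comment> \<open>substructures, partial order\<close>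
     (\<forall>(A, B) \<in> R. is_subgroup A B) \<and>
     partial_order_on K R \<and>
     \<comment> \<open>chains\<close>
     (\<forall>\<delta> A. Limit \<delta> \<and> continuous_chain K R \<delta> A \<longrightarrow>
        union_group (elts \<delta>) A \<in> K \<and>
        (\<forall>j \<in> elts \<delta>. (A j, union_group (elts \<delta>) A) \<in> R) \<and>
        (\<forall>B \<in> K. (\<forall>i \<in> elts \<delta>. (A i, B) \<in> R) \<longrightarrow> (union_group (elts \<delta>) A, B) \<in> R)) \<and>
     \<comment> \<open>coherence\<close>
     (\<forall>A B C. (A, C) \<in> R \<and> (B, C) \<in> R \<and> is_subgroup A B \<longrightarrow> (A, B) \<in> R) \<and>
     \<comment> \<open>Loewenheim-Skolem\<close>
     (\<exists>\<kappa> \<in> Card. natLeq \<le>o |elts \<kappa>| \<and>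
        (\<forall>B \<in> K. \<forall>X \<subseteq> carrier B. \<exists>A \<in> K.
           X \<subseteq> carrier A \<and> (A, B) \<in> R \<and> |carrier A| \<le>o |X| +c |elts \<kappa>| ))"

definition L_Z :: "'v monoid rel set" where
  "L_Z = {R. AEC ab_groups R \<and>
             (\<forall>A \<in> ab_groups. \<forall>B \<in> ab_groups. is_direct_summand A B \<longrightarrow> (A, B) \<in> R)}"

text \<open>The order of \<open>L_Z\<close> is reverse inclusion: stronger relations are higher.\<close>

definition L_le :: "'v monoid rel \<Rightarrow> 'v monoid rel \<Rightarrow> bool" where
  "L_le R S \<longleftrightarrow> S \<subseteq> R"

definition L_less :: "'v monoid rel \<Rightarrow> 'v monoid rel \<Rightarrow> bool" where
  "L_less R S \<longleftrightarrow> L_le R S \<and> R \<noteq> S"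


subsection \<open>The subgroups of elements of given height and isotype subgroups\<close>

lemma is_succ_of_unique:
  assumes "is_succ_of \<alpha> \<beta>" "is_succ_of \<alpha> \<gamma>"
  shows "\<beta> = \<gamma>"
proof (rule ccontr)
  assume "\<beta> \<noteq> \<gamma>"
  then have "\<beta> \<in> elts \<gamma>" "\<gamma> \<in> elts \<beta>"
    using assms unfolding is_succ_of_def by auto
  then show False
    using foundation wf_not_sym by fastforce
qed

lemma the_is_succ_of: "is_succ_of \<alpha> \<beta> \<Longrightarrow> (THE \<beta>. is_succ_of \<alpha> \<beta>) = \<beta>"
  using is_succ_of_unique by blast

text \<open>\<open>ppow p A \<alpha>\<close> is the subgroup usually written \<open>p\<^sup>\<alpha> A\<close>; only its values at ordinals matter.\<close>

function ppow :: "nat \<Rightarrow> 'v monoid \<Rightarrow> 'v \<Rightarrow> 'v set" where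
  "ppow p A \<alpha> =
     (if elts \<alpha> = {} then carrier A
      else if \<exists>\<beta>. is_succ_of \<alpha> \<beta> then (\<lambda>x. x [^]\<^bsub>A\<^esub> p) ` ppow p A (THE \<beta>. is_succ_of \<alpha> \<beta>)
      else (\<Inter>\<beta> \<in> elts \<alpha>. ppow p A \<beta>))"
  by auto
termination
proof (relation "inv_image {(x, y). x \<in> elts y} (\<lambda>(p, A, \<alpha>). \<alpha>)")
  show "wf (inv_image {(x, y). x \<in> elts y} (\<lambda>(p, A, \<alpha>). \<alpha>))"
    using foundation by (rule wf_inv_image)
qed (auto simp: the_is_succ_of, auto simp: is_succ_of_def)

declare ppow.simps [simp del]

lemma ppow_zero: "elts \<alpha> = {} \<Longrightarrow> ppow p A \<alpha> = carrier A"
  by (simp add: ppow.simps)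

lemma ppow_succ: "is_succ_of \<alpha> \<beta> \<Longrightarrow> ppow p A \<alpha> = (\<lambda>x. x [^]\<^bsub>A\<^esub> p) ` ppow p A \<beta>"
  by (subst ppow.simps) (auto simp: the_is_succ_of, auto simp: is_succ_of_def)

lemma ppow_Limit: "Limit \<alpha> \<Longrightarrow> ppow p A \<alpha> = (\<Inter>\<beta> \<in> elts \<alpha>. ppow p A \<beta>)"
  by (subst ppow.simps) (auto simp: Limit_def)

definition isotype :: "nat \<Rightarrow> 'v \<Rightarrow> 'v monoid rel" where
  "isotype p \<alpha> =
     {(A, B). A \<in> ab_groups \<and> B \<in> ab_groups \<and> is_subgroup A B \<and>
              (\<forall>\<beta> \<in> insert \<alpha> (elts \<alpha>). ppow p B \<beta> \<inter> carrier A = ppow p A \<beta>)}"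

end

end

theory Submission
  imports Defs Complex_Main "HOL-Library.Countable" "HOL-Library.Groups_Big_Fun"
begin

text \<open>
  For every ordinal \<open>\<alpha>\<close>, being \<open>p\<^sup>\<alpha>\<close>-isotype satisfies the axioms of an AEC because the subgroups
  \<open>p\<^sup>\<beta> A\<close> are built from one unary existential condition (to be a \<open>p\<close>-th power of something) and
  from intersections. Homomorphisms preserve them, which gives invariance under isomorphisms.
  Along a chain of isotype subgroups, \<open>p\<^sup>\<beta>\<close> of the union cuts every stage in \<open>p\<^sup>\<beta>\<close> of that stage: a
  root in the union already lies in some stage, and the isotype relation moves the height of its
  power between stages (\<open>ppow_U\<close>). A subgroup that contains, together with each element of
  \<open>p\<^sup>\<beta>\<^sup>+\<^sup>1 B\<close> with \<open>\<beta> < \<alpha>\<close>, one \<open>p\<close>-th root of it in \<open>p\<^sup>\<beta> B\<close> is isotype, and closing a set \<open>X\<close>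
  under the group operations and such roots yields at most \<open>\<bar>X\<bar> + \<bar>\<alpha>\<bar> + \<aleph>\<^sub>0\<close> elements
  (\<open>isotype_Loewenheim_Skolem\<close>). Finally, the components of a \<open>p\<close>-th power in a direct sum are the
  \<open>p\<close>-th powers of the components, so direct summands are isotype (\<open>summand_ppow\<close>).

  Since a longer range of ordinals is a stronger condition, the relations form a chain, and
  strictness needs, for each ordinal \<open>\<theta>\<close>, a subgroup \<open>A\<close> of a group \<open>B\<close> that is isotype up to
  \<open>\<theta>\<close> and not at \<open>\<theta> + 1\<close>. Let \<open>T(\<alpha>)\<close> be the tree of finite strictly decreasing sequences of
  ordinals below \<open>\<alpha>\<close>; the rank of a sequence is its last entry, and that of the empty sequence is
  \<open>\<alpha>\<close>. The simply presented \<open>p\<close>-group on this tree, in which \<open>p\<close> times a node is its parent and \<open>p\<close>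
  times the root is zero, has \<open>p\<^sup>\<beta>\<close> generated by the nodes of rank at least \<open>\<beta>\<close>. Instead of by
  generators and relations it is described by coordinates: it is the group of all finitely
  supported functions \<open>g\<close> from the tree to the nonzero complex numbers such that \<open>g(t)\<^sup>p\<close> is the
  product of the values of \<open>g\<close> at the children of \<open>t\<close>. A node \<open>s\<close> becomes the function whose value
  at a prefix \<open>t\<close> of \<open>s\<close> is a root of unity of order \<open>p\<^sup>k\<^sup>+\<^sup>1\<close>, with \<open>k\<close> the distance from \<open>t\<close> to \<open>s\<close>,
  chosen compatibly for all \<open>k\<close>.
  In these coordinates \<open>p\<^sup>\<beta>\<close> consists of the functions that are trivial at all nodes of rank below
  \<open>\<beta>\<close>. Limit steps are then immediate, and at a successor step a \<open>p\<close>-th root can be written down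
  (\<open>height_part_root\<close>). Now \<open>T(\<theta>)\<close> is a subtree of \<open>T(\<theta> + 1)\<close>, and the only node of \<open>T(\<theta>)\<close> whose
  rank changes is the root, from \<open>\<theta>\<close> to \<open>\<theta> + 1\<close>. Hence the group of \<open>T(\<theta>)\<close> is isotype up to \<open>\<theta>\<close> in
  that of \<open>T(\<theta> + 1)\<close>, whereas the element of order \<open>p\<close> supported at the root has height
  \<open>\<theta> + 1\<close> only in the larger group.

  The relations are therefore pairwise different for different ordinals, and the cardinals form a
  proper class by Cantor's theorem (\<open>proper_class_Card\<close>).
\<close>

section \<open>Ordinals\<close>

context zfc_universe
begin

lemma mem_irrefl [simp]: "x \<notin> elts x"
  using wf_not_refl[OF foundation] by simp

lemma mem_asym: "x \<in> elts y \<Longrightarrow> y \<notin> elts x"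
  using wf_not_sym[OF foundation] by auto

lemma mem_induct [case_names mem]:
  assumes "\<And>x. (\<And>y. y \<in> elts x \<Longrightarrow> P y) \<Longrightarrow> P x"
  shows "P x"
  using assms by (rule wf_induct_rule[OF foundation]) auto

lemma subset_is_set: "X \<subseteq> elts x \<Longrightarrow> \<exists>y. elts y = X"
  using separation by (metis rangeE)

lemma Ord_mem: "Ord \<alpha> \<Longrightarrow> \<beta> \<in> elts \<alpha> \<Longrightarrow> Ord \<beta>"
  unfolding Ord_def transitive_set_def by blast

lemma Ord_trans: "Ord \<alpha> \<Longrightarrow> \<beta> \<in> elts \<alpha> \<Longrightarrow> \<gamma> \<in> elts \<beta> \<Longrightarrow> \<gamma> \<in> elts \<alpha>"
  unfolding Ord_def transitive_set_def by blast

text \<open>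
  Of two incomparable ordinals with minimal first and then minimal second component, each would be
  a subset of the other.
\<close>

lemma Ord_linear:
  assumes "Ord \<alpha>" "Ord \<beta>"
  shows "\<alpha> \<in> elts \<beta> \<or> \<alpha> = \<beta> \<or> \<beta> \<in> elts \<alpha>"
  using assms
proof (induction \<alpha> arbitrary: \<beta> rule: mem_induct)
  case (mem \<alpha>)
  note IH\<alpha> = mem.IH and \<alpha> = \<open>Ord \<alpha>\<close>
  show ?case
    using \<open>Ord \<beta>\<close>
  proof (induction \<beta> rule: mem_induct)
    case (mem \<beta>)
    show ?case
    proof (rule ccontr)
      assume contra: "\<not> ?thesis"
      have "elts \<alpha> \<subseteq> elts \<beta>"
        using IH\<alpha>[OF _ Ord_mem[OF \<alpha>] \<open>Ord \<beta>\<close>] contra Ord_trans[OF \<alpha>] by blast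
      moreover have "elts \<beta> \<subseteq> elts \<alpha>"
        using mem.IH Ord_mem[OF \<open>Ord \<beta>\<close>] contra Ord_trans[OF \<open>Ord \<beta>\<close>] by blast
      ultimately show False
        using extensionality contra by blast
    qed
  qed
qed

lemma ex_succ:
  assumes "Ord \<beta>"
  obtains \<sigma> where "is_succ_of \<sigma> \<beta>" "Ord \<sigma>"
proof -
  obtain P where P: "elts P = {y. elts y \<subseteq> elts \<beta>}"
    using power by (metis rangeE)
  have "insert \<beta> (elts \<beta>) \<subseteq> elts P"
    \<comment> \<open>An ordinal is a transitive set of transitive sets, so its successor consists of subsets of it.\<close>
    using assms unfolding P Ord_def transitive_set_def by blast
  then obtain \<sigma> where \<sigma>: "elts \<sigma> = insert \<beta> (elts \<beta>)"
    using subset_is_set by blast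
  moreover have "Ord \<sigma>"
    using assms unfolding Ord_def transitive_set_def \<sigma> by blast
  ultimately show ?thesis
    using that unfolding is_succ_of_def by blast
qed

lemma succ_le:
  assumes "Ord \<alpha>" "\<beta> \<in> elts \<alpha>" "is_succ_of \<sigma> \<beta>"
  shows "\<sigma> \<in> insert \<alpha> (elts \<alpha>)"
proof -
  have "Ord \<beta>"
    using Ord_mem assms by blast
  then have "Ord \<sigma>"
    using ex_succ assms(3) extensionality is_succ_of_def by metis
  moreover have "\<alpha> \<notin> elts \<sigma>"
    using assms mem_asym unfolding is_succ_of_def by auto
  ultimately show ?thesis
    using Ord_linear[OF \<open>Ord \<alpha>\<close>] by blast
qed

lemma Limit_Ord: "Limit \<delta> \<Longrightarrow> Ord \<delta>"
  by (simp add: Limit_def)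

lemma Limit_succ_mem:
  assumes "Limit \<delta>" "\<beta> \<in> elts \<delta>"
  obtains \<sigma> where "is_succ_of \<sigma> \<beta>" "\<sigma> \<in> elts \<delta>"
  using assms succ_le ex_succ Ord_mem unfolding Limit_def by (metis insertE)

lemma Ord_induct [consumes 1, case_names zero succ limit]:
  assumes "Ord \<alpha>"
    and zero: "\<And>\<alpha>. elts \<alpha> = {} \<Longrightarrow> P \<alpha>"
    and succ: "\<And>\<alpha> \<beta>. Ord \<beta> \<Longrightarrow> is_succ_of \<alpha> \<beta> \<Longrightarrow> P \<beta> \<Longrightarrow> P \<alpha>"
    and limit: "\<And>\<alpha>. Limit \<alpha> \<Longrightarrow> (\<And>\<beta>. \<beta> \<in> elts \<alpha> \<Longrightarrow> P \<beta>) \<Longrightarrow> P \<alpha>"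
  shows "P \<alpha>"
  using assms(1)
proof (induction \<alpha> rule: mem_induct)
  case (mem \<alpha>)
  then have IH: "P \<beta>" if "\<beta> \<in> elts \<alpha>" for \<beta>
    using that Ord_mem by blast
  consider "elts \<alpha> = {}" | \<beta> where "is_succ_of \<alpha> \<beta>" | "Limit \<alpha>"
    using \<open>Ord \<alpha>\<close> unfolding Limit_def by blast
  then show ?case
  proof cases
    case 2
    then have "\<beta> \<in> elts \<alpha>"
      by (simp add: is_succ_of_def)
    then show ?thesis
      using succ 2 IH Ord_mem[OF \<open>Ord \<alpha>\<close>] by blast
  qed (use zero limit IH in auto)
qed

section \<open>Sizes of sets and classes\<close>

lemma ex_infinite_set:
  obtains w where "infinite (elts w)"
proof -
  obtain w z where z: "z \<in> elts w"
    and step: "\<And>y. y \<in> elts w \<Longrightarrow> \<exists>u \<in> elts w. elts u = insert y (elts y)"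
    using infinity by metis
  then obtain s where s: "\<And>y. y \<in> elts w \<Longrightarrow> s y \<in> elts w \<and> elts (s y) = insert y (elts y)"
    by metis
  define a where "a n = (s ^^ n) z" for n
  have a: "a n \<in> elts w" for n
    by (induction n) (use z s in \<open>auto simp: a_def\<close>)
  have a_Suc: "elts (a (Suc n)) = insert (a n) (elts (a n))" for n
    using s[OF a] by (simp add: a_def)
  have lt: "a m \<in> elts (a n)" if "m < n" for m n
    using that by (induction n) (auto simp: a_Suc less_Suc_eq)
  have "inj a"
  proof (rule injI)
    fix m n
    assume "a m = a n"
    then show "m = n"
      using lt[of m n] lt[of n m] by (cases m n rule: linorder_cases) auto
  qed
  then have "infinite (range a)"
    using finite_imageD by blast
  then show ?thesis
    using that a by (metis finite_subset image_subsetI)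
qed

lemma set_sized_elts [simp]: "set_sized (elts x)"
  unfolding set_sized_def using card_of_refl ordIso_imp_ordLeq by blast

lemma set_sized_mono: "set_sized Y \<Longrightarrow> |X| \<le>o |Y| \<Longrightarrow> set_sized X"
  unfolding set_sized_def using ordLeq_transitive by blast

lemma set_sized_subset: "set_sized Y \<Longrightarrow> X \<subseteq> Y \<Longrightarrow> set_sized X"
  using set_sized_mono card_of_mono1 by blast

lemma set_sized_inj_on: "inj_on f X \<Longrightarrow> f ` X \<subseteq> Y \<Longrightarrow> set_sized Y \<Longrightarrow> set_sized X"
  using set_sized_mono card_of_ordLeq by blast

lemma set_sized_infinite:
  assumes "set_sized X"
  obtains x where "infinite (elts x)" "|X| \<le>o |elts x|"
proof -
  obtain x where x: "|X| \<le>o |elts x|"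
    using assms set_sized_def by blast
  obtain w where w: "infinite (elts w)"
    by (rule ex_infinite_set)
  show ?thesis
  proof (cases "finite (elts x)")
    case True
    then have "|elts x| \<le>o |elts w|"
      using w finite_ordLess_infinite[OF card_of_Well_order card_of_Well_order, unfolded Field_card_of]
        ordLess_imp_ordLeq by blast
    then show ?thesis
      using that w x ordLeq_transitive by blast
  qed (use that x in blast)
qed

lemma set_sized_Times:
  assumes "set_sized X" "set_sized Y"
  shows "set_sized (X \<times> Y)"
proof -
  obtain x where x: "infinite (elts x)" "|X| \<le>o |elts x|"
    using assms set_sized_infinite by blast
  obtain y where y: "infinite (elts y)" "|Y| \<le>o |elts y|"
    using assms set_sized_infinite by blast
  consider "|elts x| \<le>o |elts y|" | "|elts y| \<le>o |elts x|"
    using ordLeq_total[OF card_of_Well_order card_of_Well_order] by blast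
  then obtain z where z: "infinite (elts z)" "|X| \<le>o |elts z|" "|Y| \<le>o |elts z|"
    by cases (use x y ordLeq_transitive in blast)+
  then have "|X \<times> Y| \<le>o |elts z|"
    by (intro card_of_Sigma_ordLeq_infinite) auto
  then show ?thesis
    unfolding set_sized_def by blast
qed

lemma set_sized_Pow:
  assumes "set_sized X"
  shows "set_sized (Pow X)"
proof -
  obtain x f where f: "inj_on f X" "f ` X \<subseteq> elts x"
    using assms unfolding set_sized_def card_of_ordLeq[symmetric] by blast
  obtain P where P: "elts P = {y. elts y \<subseteq> elts x}"
    using power by (metis rangeE)
  have "\<exists>y. elts y = f ` S" if "S \<subseteq> X" for S
    using that f(2) by (intro subset_is_set) auto
  then obtain g where g: "\<And>S. S \<subseteq> X \<Longrightarrow> elts (g S) = f ` S"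
    by metis
  have "inj_on g (Pow X)"
  proof (rule inj_onI)
    fix S T
    assume "S \<in> Pow X" "T \<in> Pow X" "g S = g T"
    then show "S = T"
      using g[of S] g[of T] inj_on_image_eq_iff[OF f(1), of S T] by simp
  qed
  moreover have "g ` Pow X \<subseteq> elts P"
    using g f(2) unfolding P by (auto simp: image_subset_iff)
  ultimately show ?thesis
    using set_sized_inj_on set_sized_elts by blast
qed

lemma set_sized_countable:
  fixes X :: "'b::countable set"
  shows "set_sized X"
proof -
  obtain w where w: "infinite (elts w)"
    by (rule ex_infinite_set)
  then obtain f :: "nat \<Rightarrow> 'v" where f: "inj f" "range f \<subseteq> elts w"
    using infinite_countable_subset by blast
  then have "inj_on (f \<circ> to_nat) X" "(f \<circ> to_nat) ` X \<subseteq> elts w"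
    by (simp_all add: comp_inj_on inj_on_subset[OF f(1)] image_subset_iff)
  then show ?thesis
    using set_sized_inj_on set_sized_elts by blast
qed

text \<open>A list is determined by its graph, a set of pairs of a position and an entry.\<close>

lemma set_sized_lists:
  assumes "set_sized X"
  shows "set_sized (lists X)"
proof (rule set_sized_inj_on)
  let ?g = "\<lambda>xs :: 'b list. (\<lambda>i. (i, xs ! i)) ` {..<length xs}"
  have dom: "fst ` ?g xs = {..<length xs}" for xs :: "'b list"
    by (simp add: image_image)
  show "inj_on ?g (lists X)"
  proof (rule inj_onI)
    fix xs ys :: "'b list"
    assume eq: "?g xs = ?g ys"
    then have "{..<length xs} = {..<length ys}"
      using dom by metis
    then have "length xs = length ys"
      by simp
    moreover have "xs ! i = ys ! i" if "i < length xs" for i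
    proof -
      have "(i, xs ! i) \<in> ?g ys"
        unfolding eq[symmetric] using that by simp
      then show ?thesis
        by auto
    qed
    ultimately show "xs = ys"
      by (simp add: list_eq_iff_nth_eq)
  qed
  show "?g ` lists X \<subseteq> Pow (UNIV \<times> X)"
    by (auto simp: in_lists_conv_set)
  show "set_sized (Pow ((UNIV :: nat set) \<times> X))"
    by (rule set_sized_Pow[OF set_sized_Times[OF set_sized_countable assms]])
qed

text \<open>Replacement for functions whose domain is a class of any type, as long as it has the size of a set.\<close>

lemma set_sized_image_is_set:
  assumes "set_sized X"
  obtains y where "elts y = f ` X"
proof -
  obtain x g where g: "inj_on g X" "g ` X \<subseteq> elts x"
    using assms unfolding set_sized_def card_of_ordLeq[symmetric] by blast
  obtain y where y: "elts y = g ` X"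
    using g(2) subset_is_set by blast
  have "f ` X = (f \<circ> inv_into X g) ` elts y"
    using g(1) by (simp add: y image_image)
  also have "\<dots> \<in> range elts"
    by (rule replacement)
  finally show ?thesis
    using that by blast
qed

text \<open>
  The Mostowski collapse of a well-order of least length on a set is an ordinal all of whose members
  have strictly smaller size.
\<close>

lemma ex_Card_ordIso: "\<exists>\<kappa> \<in> Card. |elts \<kappa>| =o |elts x|"
proof -
  define r where "r = |elts x|"
  have wo: "wo_rel r" and fld: "Field r = elts x"
    unfolding r_def wo_rel_def by (rule card_of_Well_order, rule Field_card_of)
  have wf: "wf (r - Id)"
    using wo_rel.WF[OF wo] .
  have sub: "underS r a \<subseteq> elts x" for a
    unfolding fld[symmetric] by (auto simp: Order_Relation.underS_def Field_def)
  have img: "\<exists>y. elts y = g ` underS r a" for g :: "'v \<Rightarrow> 'v" and a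
    by (rule set_sized_image_is_set[OF set_sized_subset[OF set_sized_elts sub]]) blast
  \<comment> \<open>The collapse: the value at \<open>a\<close> is the set of the values at the predecessors of \<open>a\<close>.\<close>
  define f where "f = wfrec (r - Id) (\<lambda>g a. SOME y. elts y = g ` underS r a)"
  have f: "elts (f a) = f ` underS r a" for a
  proof -
    have "f a = (SOME y. elts y = cut f (r - Id) a ` underS r a)"
      unfolding f_def by (subst wfrec[OF wf]) simp
    also have "cut f (r - Id) a ` underS r a = f ` underS r a"
      by (rule image_cong) (auto simp: cut_apply Order_Relation.underS_def)
    finally show ?thesis
      using someI_ex[OF img] by simp
  qed
  have inj: "inj_on f (elts x)"
  proof (rule inj_onI, rule ccontr)
    fix a b
    assume ab: "a \<in> elts x" "b \<in> elts x" "f a = f b" "a \<noteq> b"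
    then have "a \<in> underS r b \<or> b \<in> underS r a"
      using wo_rel.TOTAL[OF wo] fld by (auto simp: Order_Relation.underS_def total_on_def)
    then have "f a \<in> elts (f b) \<or> f b \<in> elts (f a)"
      using f by blast
    then show False
      using ab(3) by simp
  qed
  obtain \<kappa> where \<kappa>: "elts \<kappa> = f ` elts x"
    using replacement by (metis rangeE)
  have iso: "|elts \<kappa>| =o |elts x|"
    unfolding \<kappa> using inj by (intro card_of_ordIsoI[THEN ordIso_symmetric]) (auto simp: bij_betw_def)
  have "transitive_set \<kappa>"
    using sub unfolding transitive_set_def \<kappa> by (auto simp: f)
  moreover have "transitive_set (f a)" for a
  proof -
    have "underS r b \<subseteq> underS r a" if "b \<in> underS r a" for b
      using that wo_rel.TRANS[OF wo] wo_rel.ANTISYM[OF wo] by (auto simp: Order_Relation.underS_def trans_def antisym_def)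
    then show ?thesis
      unfolding transitive_set_def by (auto simp: f)
  qed
  moreover have "|elts (f a)| <o |elts \<kappa>|" if "a \<in> elts x" for a
  proof -
    have "|elts (f a)| \<le>o |underS r a|"
      unfolding f by (rule card_of_image)
    \<comment> \<open>Proper initial segments are smaller because \<open>r\<close> has the least possible length.\<close>
    also have "|underS r a| <o r"
      unfolding r_def
      by (rule card_of_underS[OF card_of_Card_order]) (use that in \<open>simp add: Field_card_of\<close>)
    also have "r =o |elts \<kappa>|"
      unfolding r_def by (rule ordIso_symmetric[OF iso])
    finally show ?thesis .
  qed
  ultimately have "\<kappa> \<in> Card"
    unfolding Card_def Ord_def by (auto simp: \<kappa>)
  then show ?thesis
    using iso by blast
qed

text \<open>If the cardinals formed a set, then the power set of its union would have a cardinality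
  that is a member of that set, in contradiction to Cantor's theorem.\<close>

lemma proper_class_Card: "proper_class_sized Card"
proof
  assume "set_sized Card"
  then obtain c where c: "elts c = Card"
    using set_sized_image_is_set[of Card "\<lambda>x. x"] by auto
  obtain u where u: "elts u = (\<Union>y \<in> elts c. elts y)"
    using union by (metis rangeE)
  have "set_sized (Pow (elts u))"
    by (simp add: set_sized_Pow)
  then obtain x where "|Pow (elts u)| \<le>o |elts x|"
    unfolding set_sized_def by blast
  moreover obtain \<kappa> where "\<kappa> \<in> Card" "|elts \<kappa>| =o |elts x|"
    using ex_Card_ordIso by blast
  moreover have "|elts \<kappa>| \<le>o |elts u|"
    using \<open>\<kappa> \<in> Card\<close> by (intro card_of_mono1) (auto simp: u c)
  ultimately have "|Pow (elts u)| \<le>o |elts u|"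
    using ordLeq_ordIso_trans ordIso_symmetric ordLeq_transitive by blast
  then show False
    using card_of_Pow not_ordLeq_ordLess by blast
qed

lemma Card_Ord: "\<theta> \<in> Card \<Longrightarrow> Ord \<theta>"
  by (simp add: Card_def)

section \<open>Subgroups\<close>

lemma ab_groups_comm: "A \<in> ab_groups \<Longrightarrow> comm_group A"
  by (simp add: ab_groups_def)

lemma ab_groups_group: "A \<in> ab_groups \<Longrightarrow> group A"
  using ab_groups_comm comm_group.axioms(2) by blast

text \<open>Neutral elements and inverses agree automatically, as a group has only one idempotent element.\<close>

lemma is_subgroupI:
  assumes "group A" "group B" and sub: "carrier A \<subseteq> carrier B"
    and mult: "\<And>x y. x \<in> carrier A \<Longrightarrow> y \<in> carrier A \<Longrightarrow> x \<otimes>\<^bsub>A\<^esub> y = x \<otimes>\<^bsub>B\<^esub> y"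
  shows "is_subgroup A B"
proof -
  interpret A: group A by fact
  interpret B: group B by fact
  have "\<one>\<^bsub>A\<^esub> \<otimes>\<^bsub>B\<^esub> \<one>\<^bsub>A\<^esub> = \<one>\<^bsub>A\<^esub>"
    using mult[of "\<one>\<^bsub>A\<^esub>" "\<one>\<^bsub>A\<^esub>"] by simp
  then have one: "\<one>\<^bsub>A\<^esub> = \<one>\<^bsub>B\<^esub>"
    using sub by (simp add: subset_iff)
  have "subgroup (carrier A) B"
  proof (rule B.subgroupI)
    fix x assume x: "x \<in> carrier A"
    then have "inv\<^bsub>A\<^esub> x \<otimes>\<^bsub>B\<^esub> x = \<one>\<^bsub>B\<^esub>"
      using mult[of "inv\<^bsub>A\<^esub> x" x] one by simp
    then have "inv\<^bsub>B\<^esub> x = inv\<^bsub>A\<^esub> x"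
      using B.inv_equality x sub A.inv_closed[OF x] by blast
    then show "inv\<^bsub>B\<^esub> x \<in> carrier A"
      using x by simp
  qed (use sub in \<open>auto simp flip: mult\<close>)
  then show ?thesis
    using one mult by (simp add: is_subgroup_def)
qed

lemma is_subgroup_carrier: "is_subgroup A B \<Longrightarrow> carrier A \<subseteq> carrier B"
  by (simp add: is_subgroup_def subgroup.subset)

lemma is_subgroup_mult:
  "is_subgroup A B \<Longrightarrow> x \<in> carrier A \<Longrightarrow> y \<in> carrier A \<Longrightarrow> x \<otimes>\<^bsub>A\<^esub> y = x \<otimes>\<^bsub>B\<^esub> y"
  by (simp add: is_subgroup_def)

lemma is_subgroup_refl: "group A \<Longrightarrow> is_subgroup A A"
  by (rule is_subgroupI) auto

lemma is_subgroup_trans: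
  assumes "group A" "group C" "is_subgroup A B" "is_subgroup B C"
  shows "is_subgroup A C"
proof (rule is_subgroupI[OF assms(1,2)])
  show "carrier A \<subseteq> carrier C"
    using assms is_subgroup_carrier by blast
  show "x \<otimes>\<^bsub>A\<^esub> y = x \<otimes>\<^bsub>C\<^esub> y" if "x \<in> carrier A" "y \<in> carrier A" for x y
    using that assms is_subgroup_carrier[OF assms(3)] by (simp add: is_subgroup_mult subset_iff)
qed

lemma is_subgroup_antisym:
  assumes "A \<in> ab_groups" "B \<in> ab_groups" "is_subgroup A B" "is_subgroup B A"
  shows "A = B"
proof -
  have carr: "carrier A = carrier B"
    using assms is_subgroup_carrier by blast
  have "(\<lambda>(x, y). x \<otimes>\<^bsub>A\<^esub> y) = (\<lambda>(x, y). x \<otimes>\<^bsub>B\<^esub> y)"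
    by (rule extensionalityI[of _ "carrier A \<times> carrier A"])
      (use assms(1,2) carr is_subgroup_mult[OF assms(3)] in \<open>auto simp: ab_groups_def\<close>)
  then have "monoid.mult A = monoid.mult B"
    by (simp add: fun_eq_iff)
  moreover have "\<one>\<^bsub>A\<^esub> = \<one>\<^bsub>B\<^esub>"
    using assms(3) by (simp add: is_subgroup_def)
  ultimately show ?thesis
    using carr by simp
qed

lemma is_subgroup_hom: "is_subgroup A B \<Longrightarrow> (\<lambda>x. x) \<in> hom A B"
  using is_subgroup_carrier by (fastforce simp: hom_def is_subgroup_mult)

lemma is_subgroup_nat_pow:
  "group A \<Longrightarrow> group B \<Longrightarrow> is_subgroup A B \<Longrightarrow> x \<in> carrier A \<Longrightarrow> x [^]\<^bsub>A\<^esub> (n :: nat) = x [^]\<^bsub>B\<^esub> n"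
  using hom_nat_pow[OF is_subgroup_hom] .

definition subgroup_of :: "'v monoid \<Rightarrow> 'v set \<Rightarrow> 'v monoid" where
  "subgroup_of B S = \<lparr>carrier = S,
     monoid.mult = (\<lambda>x y. if x \<in> S \<and> y \<in> S then x \<otimes>\<^bsub>B\<^esub> y else undefined), one = \<one>\<^bsub>B\<^esub>\<rparr>"

lemma carrier_subgroup_of [simp]: "carrier (subgroup_of B S) = S"
  by (simp add: subgroup_of_def)

lemma subgroup_of:
  assumes "B \<in> ab_groups" "subgroup S B"
  shows "subgroup_of B S \<in> ab_groups" "is_subgroup (subgroup_of B S) B"
proof -
  interpret B: comm_group B
    using assms(1) by (rule ab_groups_comm)
  interpret S: subgroup S B by fact
  have "comm_group (subgroup_of B S)"
    by (rule comm_groupI)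
      (auto simp: subgroup_of_def B.m_ac intro!: bexI[of _ "inv\<^bsub>B\<^esub> _"])
  moreover have "S \<in> range elts"
    using assms(1) S.subset separation by (auto simp: ab_groups_def)
  ultimately show "subgroup_of B S \<in> ab_groups"
    by (auto simp: ab_groups_def subgroup_of_def extensional_def)
  show "is_subgroup (subgroup_of B S) B"
    using assms(2) by (simp add: is_subgroup_def subgroup_of_def)
qed

section \<open>Heights and isotype subgroups\<close>

lemma ppow_carrier:
  assumes "group A" "Ord \<beta>"
  shows "ppow p A \<beta> \<subseteq> carrier A"
proof -
  interpret group A by fact
  show ?thesis
    using \<open>Ord \<beta>\<close> by (induction rule: Ord_induct) (auto simp: ppow_zero ppow_succ ppow_Limit Limit_def)
qed

lemma ppow_hom:
  assumes f: "f \<in> hom A B" and grp: "group A" "group B" and "Ord \<beta>"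
  shows "f ` ppow p A \<beta> \<subseteq> ppow p B \<beta>"
  using \<open>Ord \<beta>\<close>
proof (induction rule: Ord_induct)
  case (zero \<alpha>)
  then show ?case
    using f by (auto simp: ppow_zero hom_def)
next
  case (succ \<alpha> \<beta>)
  have "f (x [^]\<^bsub>A\<^esub> p) = f x [^]\<^bsub>B\<^esub> p" if "x \<in> ppow p A \<beta>" for x
    using hom_nat_pow[OF f _ grp] ppow_carrier[OF grp(1) \<open>Ord \<beta>\<close>] that by blast
  then show ?case
    using succ by (auto simp: ppow_succ)
next
  case (limit \<alpha>)
  then show ?case
    by (auto simp: ppow_Limit)
qed

lemma ppow_subgroup:
  "group A \<Longrightarrow> group B \<Longrightarrow> is_subgroup A B \<Longrightarrow> Ord \<beta> \<Longrightarrow> ppow p A \<beta> \<subseteq> ppow p B \<beta>"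
  using ppow_hom[OF is_subgroup_hom] by fastforce

lemma ppow_iso:
  assumes f: "f \<in> iso A B" and grp: "group A" "group B" and "Ord \<beta>"
  shows "f ` ppow p A \<beta> = ppow p B \<beta>"
proof
  have hom: "f \<in> hom A B" and bij: "bij_betw f (carrier A) (carrier B)"
    using f by (auto simp: iso_def)
  show "f ` ppow p A \<beta> \<subseteq> ppow p B \<beta>"
    using ppow_hom[OF hom grp \<open>Ord \<beta>\<close>] .
  show "ppow p B \<beta> \<subseteq> f ` ppow p A \<beta>"
  proof
    fix y
    assume y: "y \<in> ppow p B \<beta>"
    have "inv_into (carrier A) f \<in> hom B A"
      using group.iso_set_sym[OF grp(1) f] by (simp add: iso_def)
    then have "inv_into (carrier A) f y \<in> ppow p A \<beta>"
      using ppow_hom[OF _ grp(2,1) \<open>Ord \<beta>\<close>] y by blast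
    moreover have "f (inv_into (carrier A) f y) = y"
      using y ppow_carrier[OF grp(2) \<open>Ord \<beta>\<close>] bij_betw_inv_into_right[OF bij] by blast
    ultimately show "y \<in> f ` ppow p A \<beta>"
      by (metis imageI)
  qed
qed

lemma Ord_upto: "Ord \<alpha> \<Longrightarrow> \<beta> \<in> insert \<alpha> (elts \<alpha>) \<Longrightarrow> Ord \<beta>"
  using Ord_mem by blast

lemma isotypeI:
  assumes "A \<in> ab_groups" "B \<in> ab_groups" "is_subgroup A B" "Ord \<alpha>"
    and "\<And>\<beta>. \<beta> \<in> insert \<alpha> (elts \<alpha>) \<Longrightarrow> ppow p B \<beta> \<inter> carrier A \<subseteq> ppow p A \<beta>"
  shows "(A, B) \<in> isotype p \<alpha>"
proof -
  have "ppow p A \<beta> \<subseteq> ppow p B \<beta> \<inter> carrier A" if "\<beta> \<in> insert \<alpha> (elts \<alpha>)" for \<beta>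
    using ppow_subgroup[of A B \<beta>] ppow_carrier[of A \<beta>] assms ab_groups_group Ord_upto that by blast
  then show ?thesis
    using assms unfolding isotype_def by blast
qed

lemma isotypeD:
  assumes "(A, B) \<in> isotype p \<alpha>"
  shows "A \<in> ab_groups" "B \<in> ab_groups" "is_subgroup A B"
    "\<And>\<beta>. \<beta> \<in> insert \<alpha> (elts \<alpha>) \<Longrightarrow> ppow p B \<beta> \<inter> carrier A = ppow p A \<beta>"
  using assms by (auto simp: isotype_def)

text \<open>
  The components of a \<open>p\<close>-th power are the \<open>p\<close>-th powers of the components. By induction, the
  first component of an element of height at least \<open>\<beta>\<close> has height at least \<open>\<beta>\<close> already inside the
  summand. The induction runs over decomposed elements, so that the projection need not be built
  as a function.
\<close>

lemma summand_ppow: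
  assumes A: "group A" and B: "comm_group B" and sub: "is_subgroup A B"
    and C: "subgroup C B" "carrier A \<inter> C = {\<one>\<^bsub>B\<^esub>}" "carrier A <#>\<^bsub>B\<^esub> C = carrier B"
    and "Ord \<beta>"
  shows "a \<in> carrier A \<Longrightarrow> c \<in> C \<Longrightarrow> a \<otimes>\<^bsub>B\<^esub> c \<in> ppow p B \<beta> \<Longrightarrow> a \<in> ppow p A \<beta>"
  using \<open>Ord \<beta>\<close>
proof (induction arbitrary: a c rule: Ord_induct)
  case (zero \<alpha>)
  then show ?case by (simp add: ppow_zero)
next
  case (succ \<alpha> \<beta>)
  interpret A: group A by fact
  interpret B: comm_group B by fact
  interpret C: subgroup C B by fact
  interpret AB: subgroup "carrier A" B
    using sub by (simp add: is_subgroup_def)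
  obtain y where y: "y \<in> ppow p B \<beta>" "a \<otimes>\<^bsub>B\<^esub> c = y [^]\<^bsub>B\<^esub> p"
    using succ.prems(3) ppow_succ[OF succ.hyps(2)] by auto
  then have "y \<in> carrier A <#>\<^bsub>B\<^esub> C"
    using ppow_carrier[OF B.is_group \<open>Ord \<beta>\<close>] C(3) by auto
  then obtain a' c' where y': "a' \<in> carrier A" "c' \<in> C" "y = a' \<otimes>\<^bsub>B\<^esub> c'"
    by (auto simp: set_mult_def)
  have a'p: "a' [^]\<^bsub>A\<^esub> p = a' [^]\<^bsub>B\<^esub> p" "a' [^]\<^bsub>B\<^esub> p \<in> carrier A"
    using is_subgroup_nat_pow[OF A B.is_group sub y'(1)] y'(1) A.nat_pow_closed[of a' p] by simp_all
  have c'p: "c' [^]\<^bsub>B\<^esub> p \<in> C"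
    using y'(2) by (induction p) auto
  have "a \<otimes>\<^bsub>B\<^esub> c = a' [^]\<^bsub>B\<^esub> p \<otimes>\<^bsub>B\<^esub> c' [^]\<^bsub>B\<^esub> p"
    using y y' by (simp add: B.pow_mult_distrib B.m_comm)
  then have "inv\<^bsub>B\<^esub> (a' [^]\<^bsub>B\<^esub> p) \<otimes>\<^bsub>B\<^esub> a = c' [^]\<^bsub>B\<^esub> p \<otimes>\<^bsub>B\<^esub> inv\<^bsub>B\<^esub> c" (is "?l = ?r")
    using succ.prems a'p c'p
    by (smt (verit) AB.mem_carrier B.inv_closed B.inv_solve_left B.inv_solve_right B.m_assoc B.m_closed C.mem_carrier)
  moreover have l: "?l \<in> carrier A" and "?r \<in> C"
    using succ.prems a'p c'p by auto
  ultimately have "?l \<in> carrier A \<inter> C"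
    by (simp only: Int_iff)
  then have "?l = \<one>\<^bsub>B\<^esub>"
    unfolding C(2) by simp
  then have "a = a' [^]\<^bsub>B\<^esub> p"
    using succ.prems(1) a'p(2) B.inv_solve_left[of "\<one>\<^bsub>B\<^esub>" "a' [^]\<^bsub>B\<^esub> p" a] by simp
  moreover have "a' \<in> ppow p A \<beta>"
    using succ.IH y y' by blast
  ultimately show ?case
    unfolding ppow_succ[OF succ.hyps(2)] using a'p by (metis imageI)
next
  case (limit \<alpha>)
  then show ?case
    by (auto simp: ppow_Limit)
qed

lemma direct_summand_isotype:
  assumes "A \<in> ab_groups" "B \<in> ab_groups" "is_direct_summand A B" "Ord \<alpha>"
  shows "(A, B) \<in> isotype p \<alpha>"
proof -
  obtain C where C: "subgroup C B" "carrier A \<inter> C = {\<one>\<^bsub>B\<^esub>}" "carrier A <#>\<^bsub>B\<^esub> C = carrier B"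
    and sub: "is_subgroup A B"
    using assms(3) by (auto simp: is_direct_summand_def)
  interpret B: comm_group B
    using assms(2) by (rule ab_groups_comm)
  show ?thesis
  proof (rule isotypeI)
    fix \<beta>
    assume "\<beta> \<in> insert \<alpha> (elts \<alpha>)"
    then have "Ord \<beta>"
      using Ord_upto \<open>Ord \<alpha>\<close> by blast
    show "ppow p B \<beta> \<inter> carrier A \<subseteq> ppow p A \<beta>"
    proof
      fix a
      assume a: "a \<in> ppow p B \<beta> \<inter> carrier A"
      then have "a \<otimes>\<^bsub>B\<^esub> \<one>\<^bsub>B\<^esub> \<in> ppow p B \<beta>"
        using is_subgroup_carrier[OF sub] by auto
      then show "a \<in> ppow p A \<beta>"
        using summand_ppow[OF ab_groups_group B.comm_group_axioms sub C \<open>Ord \<beta>\<close>] assms(1) a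
          subgroup.one_closed[OF C(1)] by blast
    qed
  qed (use assms sub in auto)
qed

end

section \<open>Unions of chains\<close>

text \<open>
  Any two stages of the chain lie in a common one. This reduces the group laws of the union, and the
  independence of its operation from the stages picked by the choice operator, to a single stage.
\<close>

locale group_chain =
  zfc_universe elts for elts :: "'v \<Rightarrow> 'v set" +
  fixes \<delta> :: 'v and A :: "'v \<Rightarrow> 'v monoid"
  assumes limit: "Limit \<delta>"
    and ab: "\<And>i. i \<in> elts \<delta> \<Longrightarrow> A i \<in> ab_groups"
    and sub: "\<And>i j. j \<in> elts \<delta> \<Longrightarrow> i \<in> elts j \<Longrightarrow> is_subgroup (A i) (A j)"

context group_chain
begin

abbreviation "U \<equiv> union_group (elts \<delta>) A"

lemma common_upper_stage:
  assumes "i \<in> elts \<delta>" "j \<in> elts \<delta>"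
  obtains k where "k \<in> elts \<delta>" "is_subgroup (A i) (A k)" "is_subgroup (A j) (A k)"
proof -
  consider "i \<in> elts j" | "i = j" | "j \<in> elts i"
    using Ord_linear Ord_mem[OF Limit_Ord[OF limit]] assms by blast
  then show ?thesis
    by cases (use assms sub that ab ab_groups_group is_subgroup_refl in blast)+
qed

lemma carrier_U: "carrier U = (\<Union>i \<in> elts \<delta>. carrier (A i))"
  by (simp add: union_group_def)

lemma mult_agree:
  assumes "i \<in> elts \<delta>" "j \<in> elts \<delta>" "{x, y} \<subseteq> carrier (A i)" "{x, y} \<subseteq> carrier (A j)"
  shows "x \<otimes>\<^bsub>A i\<^esub> y = x \<otimes>\<^bsub>A j\<^esub> y"
  by (rule common_upper_stage[OF assms(1,2)]) (use assms is_subgroup_mult in fastforce)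

lemma mult_U:
  assumes "i \<in> elts \<delta>" "x \<in> carrier (A i)" "y \<in> carrier (A i)"
  shows "x \<otimes>\<^bsub>U\<^esub> y = x \<otimes>\<^bsub>A i\<^esub> y"
proof -
  let ?P = "\<lambda>i. i \<in> elts \<delta> \<and> x \<in> carrier (A i) \<and> y \<in> carrier (A i)"
  have "?P (SOME i. ?P i)"
    by (rule someI[of ?P i]) (use assms in auto)
  moreover have "x \<otimes>\<^bsub>U\<^esub> y = x \<otimes>\<^bsub>A (SOME i. ?P i)\<^esub> y"
    using assms by (auto simp: union_group_def)
  ultimately show ?thesis
    using mult_agree[OF assms(1), of "SOME i. ?P i" x y] assms by auto
qed

lemma mult_U_undefined: "x \<notin> carrier U \<or> y \<notin> carrier U \<Longrightarrow> x \<otimes>\<^bsub>U\<^esub> y = undefined"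
  by (auto simp: union_group_def)

lemma one_agree:
  assumes "i \<in> elts \<delta>" "j \<in> elts \<delta>"
  shows "\<one>\<^bsub>A i\<^esub> = \<one>\<^bsub>A j\<^esub>"
  by (rule common_upper_stage[OF assms]) (simp add: is_subgroup_def)

lemma one_U:
  assumes "i \<in> elts \<delta>"
  shows "\<one>\<^bsub>U\<^esub> = \<one>\<^bsub>A i\<^esub>"
proof -
  have "(SOME i. i \<in> elts \<delta>) \<in> elts \<delta>"
    using assms by (rule someI)
  then show ?thesis
    using one_agree[OF _ assms, of "SOME i. i \<in> elts \<delta>"] by (simp add: union_group_def)
qed

lemma common_stage:
  assumes "x \<in> carrier U" "y \<in> carrier U"
  obtains i where "i \<in> elts \<delta>" "x \<in> carrier (A i)" "y \<in> carrier (A i)"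
proof -
  obtain i j where ij: "i \<in> elts \<delta>" "j \<in> elts \<delta>" "x \<in> carrier (A i)" "y \<in> carrier (A j)"
    using assms by (auto simp: carrier_U)
  show ?thesis
    by (rule common_upper_stage[OF ij(1,2)]) (use ij that is_subgroup_carrier in blast)
qed

lemma U_comm_group: "comm_group U"
proof (rule comm_groupI)
  fix x y
  assume "x \<in> carrier U" "y \<in> carrier U"
  then obtain i where i: "i \<in> elts \<delta>" "x \<in> carrier (A i)" "y \<in> carrier (A i)"
    by (rule common_stage)
  interpret Ai: comm_group "A i"
    using ab[OF i(1)] by (rule ab_groups_comm)
  show "x \<otimes>\<^bsub>U\<^esub> y \<in> carrier U"
    using i by (auto simp: mult_U carrier_U)
  show "x \<otimes>\<^bsub>U\<^esub> y = y \<otimes>\<^bsub>U\<^esub> x"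
    using i by (simp add: mult_U[OF i(1)] Ai.m_comm)
next
  obtain i where i: "i \<in> elts \<delta>"
    using limit by (auto simp: Limit_def)
  interpret Ai: comm_group "A i"
    using ab[OF i(1)] by (rule ab_groups_comm)
  show "\<one>\<^bsub>U\<^esub> \<in> carrier U"
    using i by (auto simp: carrier_U one_U)
next
  fix x y z
  assume xyz: "x \<in> carrier U" "y \<in> carrier U" "z \<in> carrier U"
  obtain i where i: "i \<in> elts \<delta>" "x \<in> carrier (A i)" "y \<in> carrier (A i)"
    by (rule common_stage[OF xyz(1,2)])
  obtain j where j: "j \<in> elts \<delta>" "z \<in> carrier (A j)"
    using xyz by (auto simp: carrier_U)
  obtain k where k: "k \<in> elts \<delta>" "is_subgroup (A i) (A k)" "is_subgroup (A j) (A k)"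
    by (rule common_upper_stage[OF i(1) j(1)])
  have mem: "x \<in> carrier (A k)" "y \<in> carrier (A k)" "z \<in> carrier (A k)"
    using i j k is_subgroup_carrier by blast+
  interpret Ak: comm_group "A k"
    using ab[OF k(1)] by (rule ab_groups_comm)
  show "x \<otimes>\<^bsub>U\<^esub> y \<otimes>\<^bsub>U\<^esub> z = x \<otimes>\<^bsub>U\<^esub> (y \<otimes>\<^bsub>U\<^esub> z)"
    using mem by (simp add: mult_U[OF k(1)] Ak.m_assoc)
next
  fix x
  assume "x \<in> carrier U"
  then obtain i where i: "i \<in> elts \<delta>" "x \<in> carrier (A i)"
    by (auto simp: carrier_U)
  interpret Ai: comm_group "A i"
    using ab[OF i(1)] by (rule ab_groups_comm)
  show "\<one>\<^bsub>U\<^esub> \<otimes>\<^bsub>U\<^esub> x = x"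
    using i by (simp add: one_U[OF i(1)] mult_U[OF i(1)])
  have "inv\<^bsub>A i\<^esub> x \<otimes>\<^bsub>U\<^esub> x = \<one>\<^bsub>U\<^esub>" "inv\<^bsub>A i\<^esub> x \<in> carrier U"
    using i by (auto simp: one_U[OF i(1)] mult_U[OF i(1)] carrier_U)
  then show "\<exists>y \<in> carrier U. y \<otimes>\<^bsub>U\<^esub> x = \<one>\<^bsub>U\<^esub>"
    by blast
qed

lemma U_ab_groups: "U \<in> ab_groups"
proof -
  have "\<forall>i \<in> elts \<delta>. \<exists>c. elts c = carrier (A i)"
  proof
    fix i
    assume "i \<in> elts \<delta>"
    then have "carrier (A i) \<in> range elts"
      using ab by (simp add: ab_groups_def)
    then show "\<exists>c. elts c = carrier (A i)"
      by (metis rangeE)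
  qed
  then obtain c where c: "\<And>i. i \<in> elts \<delta> \<Longrightarrow> elts (c i) = carrier (A i)"
    by metis
  obtain z where z: "elts z = c ` elts \<delta>"
    using replacement by (metis rangeE)
  have "carrier U = (\<Union>y \<in> elts z. elts y)"
    using c by (simp add: z carrier_U)
  then have "carrier U \<in> range elts"
    using union by simp
  then show ?thesis
    using U_comm_group mult_U_undefined by (auto simp: ab_groups_def extensional_def)
qed

lemma sub_U: "i \<in> elts \<delta> \<Longrightarrow> is_subgroup (A i) U"
  by (rule is_subgroupI) (use ab_groups_group[OF ab] ab_groups_group[OF U_ab_groups] mult_U in \<open>auto simp: carrier_U\<close>)

lemma U_sub:
  assumes "group B" "\<And>i. i \<in> elts \<delta> \<Longrightarrow> is_subgroup (A i) B"
  shows "is_subgroup U B"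
proof (rule is_subgroupI)
  fix x y
  assume "x \<in> carrier U" "y \<in> carrier U"
  then obtain i where i: "i \<in> elts \<delta>" "x \<in> carrier (A i)" "y \<in> carrier (A i)"
    by (rule common_stage)
  then show "x \<otimes>\<^bsub>U\<^esub> y = x \<otimes>\<^bsub>B\<^esub> y"
    using assms(2) is_subgroup_mult mult_U by metis
qed (use assms ab_groups_group[OF U_ab_groups] is_subgroup_carrier in \<open>auto simp: carrier_U\<close>)

text \<open>
  In the successor step, the root \<open>y\<close> of an element \<open>x\<close> of stage \<open>j\<close> lies in some stage \<open>i\<close>, where the
  induction hypothesis applies, so \<open>x\<close> has the right height in stage \<open>i\<close>. If \<open>i\<close> comes before \<open>j\<close>,
  heights only grow on the way to \<open>j\<close>; if it comes after \<open>j\<close>, then stage \<open>j\<close> is isotype in stage \<open>i\<close>.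
\<close>

lemma ppow_U:
  assumes "Ord \<alpha>" and iso: "\<And>i j. j \<in> elts \<delta> \<Longrightarrow> i \<in> elts j \<Longrightarrow> (A i, A j) \<in> isotype p \<alpha>"
    and "Ord \<beta>"
  shows "\<beta> \<in> insert \<alpha> (elts \<alpha>) \<Longrightarrow> j \<in> elts \<delta> \<Longrightarrow> ppow p U \<beta> \<inter> carrier (A j) \<subseteq> ppow p (A j) \<beta>"
  using \<open>Ord \<beta>\<close>
proof (induction arbitrary: j rule: Ord_induct)
  case (zero \<beta>)
  then show ?case by (simp add: ppow_zero)
next
  case (succ \<beta> \<gamma>)
  have \<gamma>: "\<gamma> \<in> elts \<beta>"
    using succ.hyps by (simp add: is_succ_of_def)
  have IH: "ppow p U \<gamma> \<inter> carrier (A i) \<subseteq> ppow p (A i) \<gamma>" if "i \<in> elts \<delta>" for i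
    using succ.IH[OF _ that] \<gamma> succ.prems(1) Ord_trans[OF \<open>Ord \<alpha>\<close>] by blast
  show ?case
  proof
    fix x
    assume x: "x \<in> ppow p U \<beta> \<inter> carrier (A j)"
    then obtain y where y: "y \<in> ppow p U \<gamma>" "x = y [^]\<^bsub>U\<^esub> p"
      using ppow_succ[OF succ.hyps(2)] by auto
    then obtain i where i: "i \<in> elts \<delta>" "y \<in> carrier (A i)"
      using ppow_carrier[OF ab_groups_group[OF U_ab_groups] \<open>Ord \<gamma>\<close>] by (auto simp: carrier_U)
    have xi: "x \<in> ppow p (A i) \<beta>"
      using IH[OF i(1)] i y is_subgroup_nat_pow[OF ab_groups_group[OF ab] ab_groups_group[OF U_ab_groups] sub_U]
      by (auto simp: ppow_succ[OF succ.hyps(2)] intro!: image_eqI[of _ _ y])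
    have ord: "Ord \<beta>"
      using Ord_upto[OF \<open>Ord \<alpha>\<close> succ.prems(1)] .
    consider "i \<in> elts j" | "i = j" | "j \<in> elts i"
      using Ord_linear Ord_mem[OF Limit_Ord[OF limit]] i(1) succ.prems(2) by blast
    then show "x \<in> ppow p (A j) \<beta>"
    proof cases
      case 1
      then show ?thesis
        using ppow_subgroup[OF ab_groups_group[OF ab[OF i(1)]] ab_groups_group[OF ab] sub ord] xi succ.prems(2)
        by blast
    next
      case 3
      then show ?thesis
        using isotypeD(4)[OF iso[OF i(1)] succ.prems(1)] x xi by blast
    qed (use xi in simp)
  qed
next
  case (limit \<beta>)
  have "ppow p U \<gamma> \<inter> carrier (A j) \<subseteq> ppow p (A j) \<gamma>" if "\<gamma> \<in> elts \<beta>" for \<gamma>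
    using limit.IH[OF that _ limit.prems(2)] limit.prems(1) Ord_trans[OF \<open>Ord \<alpha>\<close>] that by blast
  then show ?case
    using limit.hyps by (auto simp: ppow_Limit)
qed

end

context zfc_universe
begin

lemma isotype_union_chain:
  assumes "Limit \<delta>" "continuous_chain ab_groups (isotype p \<alpha>) \<delta> A" "Ord \<alpha>"
  shows "union_group (elts \<delta>) A \<in> ab_groups"
    "\<And>j. j \<in> elts \<delta> \<Longrightarrow> (A j, union_group (elts \<delta>) A) \<in> isotype p \<alpha>"
    "\<And>B. B \<in> ab_groups \<Longrightarrow> (\<And>i. i \<in> elts \<delta> \<Longrightarrow> (A i, B) \<in> isotype p \<alpha>) \<Longrightarrow>
       (union_group (elts \<delta>) A, B) \<in> isotype p \<alpha>"
proof -
  have iso: "(A i, A j) \<in> isotype p \<alpha>" if "j \<in> elts \<delta>" "i \<in> elts j" for i j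
    using assms(2) that by (simp add: continuous_chain_def)
  interpret group_chain elts \<delta> A
  proof
    show "A i \<in> ab_groups" if "i \<in> elts \<delta>" for i
      using assms(2) that by (simp add: continuous_chain_def)
    show "is_subgroup (A i) (A j)" if "j \<in> elts \<delta>" "i \<in> elts j" for i j
      by (rule isotypeD(3)[OF iso[OF that]])
  qed (rule assms(1))
  show "U \<in> ab_groups"
    by (rule U_ab_groups)
  show "(A j, U) \<in> isotype p \<alpha>" if "j \<in> elts \<delta>" for j
    by (rule isotypeI[OF ab[OF that] U_ab_groups sub_U[OF that] \<open>Ord \<alpha>\<close>])
      (use ppow_U[OF \<open>Ord \<alpha>\<close> iso] Ord_upto[OF \<open>Ord \<alpha>\<close>] that in blast)
  show "(U, B) \<in> isotype p \<alpha>" if B: "B \<in> ab_groups" and le: "\<And>i. i \<in> elts \<delta> \<Longrightarrow> (A i, B) \<in> isotype p \<alpha>" for B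
  proof (rule isotypeI[OF U_ab_groups B _ \<open>Ord \<alpha>\<close>])
    show "is_subgroup U B"
      using U_sub ab_groups_group[OF B] isotypeD(3)[OF le] by blast
    fix \<beta>
    assume \<beta>: "\<beta> \<in> insert \<alpha> (elts \<alpha>)"
    have "ppow p B \<beta> \<inter> carrier (A i) \<subseteq> ppow p U \<beta>" if "i \<in> elts \<delta>" for i
      using isotypeD(4)[OF le[OF that] \<beta>]
        ppow_subgroup[OF ab_groups_group[OF ab[OF that]] ab_groups_group[OF U_ab_groups] sub_U[OF that] Ord_upto[OF \<open>Ord \<alpha>\<close> \<beta>]]
      by blast
    then show "ppow p B \<beta> \<inter> carrier U \<subseteq> ppow p U \<beta>"
      by (auto simp: carrier_U)
  qed
qed

section \<open>The Loewenheim-Skolem property\<close>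

text \<open>
  Besides closing under the group operations, each step adds one \<open>p\<close>-th root in \<open>ppow p B \<beta>\<close> of every
  element that has one, for every \<open>\<beta>\<close> in \<open>\<alpha>\<close>. The neutral element is the default value for
  elements without such a root, so that it adds nothing new.
\<close>

primrec root_closure :: "nat \<Rightarrow> 'v monoid \<Rightarrow> 'v \<Rightarrow> 'v set \<Rightarrow> nat \<Rightarrow> 'v set" where
  "root_closure p B \<alpha> X 0 = insert \<one>\<^bsub>B\<^esub> X"
| "root_closure p B \<alpha> X (Suc n) =
     (\<lambda>(x, y). x \<otimes>\<^bsub>B\<^esub> y) ` (root_closure p B \<alpha> X n \<times> root_closure p B \<alpha> X n) \<union>
     m_inv B ` root_closure p B \<alpha> X n \<union>
     (\<lambda>(x, \<beta>). if x \<in> (\<lambda>y. y [^]\<^bsub>B\<^esub> p) ` ppow p B \<beta> then SOME y. y \<in> ppow p B \<beta> \<and> x = y [^]\<^bsub>B\<^esub> p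
               else \<one>\<^bsub>B\<^esub>) ` (root_closure p B \<alpha> X n \<times> elts \<alpha>)"

lemma card_root_closure:
  assumes "Cinfinite r" "|X| \<le>o r" "|elts \<alpha>| \<le>o r"
  shows "|\<Union>n. root_closure p B \<alpha> X n| \<le>o r"
proof (rule UNION_Cinfinite_bound)
  have Times: "|Y \<times> Z| \<le>o r" if "|Y| \<le>o r" "|Z| \<le>o r" for Y :: "'v set" and Z :: "'v set"
    using cprod_cinfinite_bound[OF that card_of_Card_order card_of_Card_order assms(1)]
    by (simp add: cprod_def Field_card_of)
  have image: "|f ` Y| \<le>o r" if "|Y| \<le>o r" for f :: "'c \<Rightarrow> 'v" and Y :: "'c set"
    using card_of_image that by (rule ordLeq_transitive)
  have "|root_closure p B \<alpha> X n| \<le>o r" for n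
  proof (induction n)
    case 0
    have "|{\<one>\<^bsub>B\<^esub>}| \<le>o r"
      using assms(1) by (intro Card_order_singl_ordLeq) (auto simp: cinfinite_def)
    then show ?case
      using Un_Cinfinite_bound[OF _ assms(2,1), of "{\<one>\<^bsub>B\<^esub>}"] by simp
  next
    case (Suc n)
    then show ?case
      unfolding root_closure.simps by (intro Un_Cinfinite_bound image Times assms)
  qed
  then show "\<forall>n \<in> UNIV. |root_closure p B \<alpha> X n| \<le>o r"
    by blast
  show "|UNIV :: nat set| \<le>o r"
    using assms(1) natLeq_ordLeq_cinfinite card_of_nat ordIso_ordLeq_trans by blast
qed (rule assms(1))

lemma root_closure:
  fixes p :: nat
  assumes "group B" "Ord \<alpha>" "X \<subseteq> carrier B"
  defines "S \<equiv> \<Union>n. root_closure p B \<alpha> X n"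
  shows "subgroup S B" "X \<subseteq> S"
    "\<And>x \<beta>. x \<in> S \<Longrightarrow> \<beta> \<in> elts \<alpha> \<Longrightarrow> x \<in> (\<lambda>y. y [^]\<^bsub>B\<^esub> p) ` ppow p B \<beta> \<Longrightarrow>
      \<exists>y \<in> ppow p B \<beta> \<inter> S. x = y [^]\<^bsub>B\<^esub> p"
proof -
  interpret B: group B by fact
  let ?C = "root_closure p B \<alpha> X"
  define h where "h x \<beta> = (if x \<in> (\<lambda>y. y [^]\<^bsub>B\<^esub> p) ` ppow p B \<beta>
    then SOME y. y \<in> ppow p B \<beta> \<and> x = y [^]\<^bsub>B\<^esub> p else \<one>\<^bsub>B\<^esub>)" for x \<beta>
  have h: "h x \<beta> \<in> ppow p B \<beta> \<and> x = h x \<beta> [^]\<^bsub>B\<^esub> p" if "x \<in> (\<lambda>y. y [^]\<^bsub>B\<^esub> p) ` ppow p B \<beta>" for x \<beta>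
    unfolding h_def if_P[OF that] by (rule someI_ex) (use that in blast)
  have h_carrier: "h x \<beta> \<in> carrier B" if "\<beta> \<in> elts \<alpha>" for x \<beta>
  proof (cases "x \<in> (\<lambda>y. y [^]\<^bsub>B\<^esub> p) ` ppow p B \<beta>")
    case True
    then show ?thesis
      using h ppow_carrier[OF \<open>group B\<close> Ord_mem[OF \<open>Ord \<alpha>\<close> that]] by blast
  qed (simp add: h_def)
  have C_Suc: "?C (Suc n) = (\<lambda>(x, y). x \<otimes>\<^bsub>B\<^esub> y) ` (?C n \<times> ?C n) \<union> m_inv B ` ?C n \<union>
      (\<lambda>(x, \<beta>). h x \<beta>) ` (?C n \<times> elts \<alpha>)" for n
    by (simp add: h_def)
  have C_carrier: "?C n \<subseteq> carrier B" for n
  proof (induction n)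
    case 0
    then show ?case
      using assms(3) by simp
  next
    case (Suc n)
    then show ?case
      unfolding C_Suc using h_carrier by auto
  qed
  have one: "\<one>\<^bsub>B\<^esub> \<in> ?C n" for n
  proof (induction n)
    case (Suc n)
    then have "inv\<^bsub>B\<^esub> \<one>\<^bsub>B\<^esub> \<in> m_inv B ` ?C n"
      by (rule imageI)
    then show ?case
      unfolding C_Suc by simp
  qed simp
  have C_mono: "?C n \<subseteq> ?C (Suc n)" for n
  proof
    fix x
    assume x: "x \<in> ?C n"
    then have "x = x \<otimes>\<^bsub>B\<^esub> \<one>\<^bsub>B\<^esub>"
      using C_carrier[of n] by auto
    then show "x \<in> ?C (Suc n)"
      unfolding C_Suc using x one[of n] by (intro UnI1 image_eqI[of _ _ "(x, \<one>\<^bsub>B\<^esub>)"]) auto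
  qed
  have C_le: "?C m \<subseteq> ?C n" if "m \<le> n" for m n
    using that C_mono by (rule lift_Suc_mono_le[rotated])
  show "subgroup S B"
  proof (rule B.subgroupI)
    show "S \<subseteq> carrier B"
      unfolding S_def using C_carrier by blast
    show "S \<noteq> {}"
      unfolding S_def using one by blast
  next
    fix x
    assume "x \<in> S"
    then obtain n where "x \<in> ?C n"
      by (auto simp: S_def)
    then have "inv\<^bsub>B\<^esub> x \<in> ?C (Suc n)"
      unfolding C_Suc by blast
    then show "inv\<^bsub>B\<^esub> x \<in> S"
      unfolding S_def by blast
  next
    fix x y
    assume "x \<in> S" "y \<in> S"
    then obtain m n where "x \<in> ?C m" "y \<in> ?C n"
      by (auto simp: S_def)
    then have "(x, y) \<in> ?C (max m n) \<times> ?C (max m n)"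
      using C_le[of m "max m n"] C_le[of n "max m n"] by auto
    then have "x \<otimes>\<^bsub>B\<^esub> y \<in> ?C (Suc (max m n))"
      unfolding C_Suc by (intro UnI1 image_eqI[of _ _ "(x, y)"]) auto
    then show "x \<otimes>\<^bsub>B\<^esub> y \<in> S"
      unfolding S_def by blast
  qed
  show "X \<subseteq> S"
    unfolding S_def by (rule order_trans[OF _ UN_upper[of 0]]) auto
  fix x \<beta>
  assume x: "x \<in> S" "\<beta> \<in> elts \<alpha>" "x \<in> (\<lambda>y. y [^]\<^bsub>B\<^esub> p) ` ppow p B \<beta>"
  then obtain n where "x \<in> ?C n"
    by (auto simp: S_def)
  then have "h x \<beta> \<in> ?C (Suc n)"
    unfolding C_Suc using x(2) by (intro UnI2 image_eqI[of _ _ "(x, \<beta>)"]) auto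
  then have "h x \<beta> \<in> S"
    unfolding S_def by blast
  then show "\<exists>y \<in> ppow p B \<beta> \<inter> S. x = y [^]\<^bsub>B\<^esub> p"
    using h[OF x(3)] by blast
qed

text \<open>
  A subgroup closed under the chosen roots is isotype: by induction on \<open>\<beta>\<close>, an element of it that has
  height at least \<open>\<beta> + 1\<close> in \<open>B\<close> is the power of a chosen root, which has height at least \<open>\<beta>\<close> in the
  subgroup.
\<close>

lemma isotype_Loewenheim_Skolem:
  assumes B: "B \<in> ab_groups" and "Ord \<alpha>" and "X \<subseteq> carrier B"
    and \<kappa>: "natLeq \<le>o |elts \<kappa>|" "|elts \<alpha>| \<le>o |elts \<kappa>|"
  shows "\<exists>A \<in> ab_groups. X \<subseteq> carrier A \<and> (A, B) \<in> isotype p \<alpha> \<and> |carrier A| \<le>o |X| +c |elts \<kappa>|"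
proof -
  define S where "S = (\<Union>n. root_closure p B \<alpha> X n)"
  note S = root_closure[where p = p, OF ab_groups_group[OF B] assms(2,3), folded S_def]
  let ?A = "subgroup_of B S"
  note A = subgroup_of[OF B S(1)]
  have "ppow p B \<beta> \<inter> S \<subseteq> ppow p ?A \<beta>" if "\<beta> \<in> insert \<alpha> (elts \<alpha>)" "Ord \<beta>" for \<beta>
    using that(2,1)
  proof (induction rule: Ord_induct)
    case (zero \<beta>)
    then show ?case
      by (simp add: ppow_zero)
  next
    case (succ \<beta> \<gamma>)
    then have "\<gamma> \<in> elts \<beta>"
      by (simp add: is_succ_of_def)
    then have \<gamma>: "\<gamma> \<in> elts \<alpha>"
      using succ.prems Ord_trans[OF \<open>Ord \<alpha>\<close>] by blast
    show ?case
    proof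
      fix x
      assume "x \<in> ppow p B \<beta> \<inter> S"
      then obtain y where y: "y \<in> ppow p B \<gamma>" "y \<in> S" "x = y [^]\<^bsub>B\<^esub> p"
        using S(3)[OF _ \<gamma>, of x] unfolding ppow_succ[OF succ.hyps(2)] by blast
      then have "y \<in> ppow p ?A \<gamma>"
        using succ.IH \<gamma> by blast
      moreover have "x = y [^]\<^bsub>?A\<^esub> p"
        using is_subgroup_nat_pow[OF ab_groups_group[OF A(1)] ab_groups_group[OF B] A(2)] y by simp
      ultimately show "x \<in> ppow p ?A \<beta>"
        unfolding ppow_succ[OF succ.hyps(2)] by blast
    qed
  next
    case (limit \<beta>)
    have "ppow p B \<gamma> \<inter> S \<subseteq> ppow p ?A \<gamma>" if "\<gamma> \<in> elts \<beta>" for \<gamma>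
      using limit.IH[OF that] limit.prems Ord_trans[OF \<open>Ord \<alpha>\<close>] that by blast
    then show ?case
      using limit.hyps by (auto simp: ppow_Limit)
  qed
  then have "(?A, B) \<in> isotype p \<alpha>"
    using Ord_upto[OF \<open>Ord \<alpha>\<close>] by (intro isotypeI A B \<open>Ord \<alpha>\<close>) simp
  moreover have "|S| \<le>o |X| +c |elts \<kappa>|"
    unfolding S_def
  proof (rule card_root_closure)
    have "cinfinite |elts \<kappa>|"
      using \<kappa>(1) natLeq_cinfinite by (rule cinfinite_mono)
    then show "Cinfinite ( |X| +c |elts \<kappa>| )"
      by (intro Cinfinite_csum) (simp add: card_of_Card_order)
    show "|X| \<le>o |X| +c |elts \<kappa>|"
      by (rule ordLeq_csum1[OF card_of_Card_order])
    show "|elts \<alpha>| \<le>o |X| +c |elts \<kappa>|"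
      by (rule ordLeq_transitive[OF \<kappa>(2) ordLeq_csum2[OF card_of_Card_order]])
  qed
  ultimately show ?thesis
    using A(1) S(2) by (intro bexI[of _ ?A]) simp_all
qed

section \<open>The abstract elementary classes of isotype subgroups\<close>

lemma isotype_closed_iso:
  assumes "(A, B) \<in> isotype p \<alpha>" "A' \<in> ab_groups" "B' \<in> ab_groups"
    and f: "f \<in> iso B B'" "f \<in> iso A A'" and "Ord \<alpha>"
  shows "(A', B') \<in> isotype p \<alpha>"
proof (rule isotypeI)
  note AB = isotypeD[OF assms(1)]
  have A': "carrier A' = f ` carrier A" and B': "carrier B' = f ` carrier B" and inj: "inj_on f (carrier B)"
    using f by (auto simp: iso_def bij_betw_def)
  have sub: "carrier A \<subseteq> carrier B"
    by (rule is_subgroup_carrier[OF AB(3)])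
  show "is_subgroup A' B'"
  proof (rule is_subgroupI)
    show "carrier A' \<subseteq> carrier B'"
      using sub A' B' by blast
    fix x y
    assume "x \<in> carrier A'" "y \<in> carrier A'"
    then obtain a b where ab: "a \<in> carrier A" "b \<in> carrier A" "x = f a" "y = f b"
      using A' by blast
    then have "x \<otimes>\<^bsub>A'\<^esub> y = f (a \<otimes>\<^bsub>A\<^esub> b)"
      using f(2) by (simp add: iso_def hom_def)
    also have "\<dots> = f (a \<otimes>\<^bsub>B\<^esub> b)"
      using is_subgroup_mult[OF AB(3)] ab by simp
    also have "\<dots> = x \<otimes>\<^bsub>B'\<^esub> y"
      using f(1) ab sub by (auto simp: iso_def hom_def)
    finally show "x \<otimes>\<^bsub>A'\<^esub> y = x \<otimes>\<^bsub>B'\<^esub> y" .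
  qed (use assms ab_groups_group in auto)
  fix \<beta>
  assume \<beta>: "\<beta> \<in> insert \<alpha> (elts \<alpha>)"
  have "Ord \<beta>"
    using Ord_upto[OF \<open>Ord \<alpha>\<close> \<beta>] .
  have "ppow p B' \<beta> \<inter> carrier A' = f ` ppow p B \<beta> \<inter> f ` carrier A"
    using ppow_iso[OF f(1)] AB(2) assms(3) ab_groups_group \<open>Ord \<beta>\<close> by (simp add: A')
  also have "\<dots> = f ` (ppow p B \<beta> \<inter> carrier A)"
    using inj_on_image_Int[OF inj ppow_carrier[OF ab_groups_group[OF AB(2)] \<open>Ord \<beta>\<close>] sub] by simp
  also have "\<dots> = ppow p A' \<beta>"
    using AB(4)[OF \<beta>] ppow_iso[OF f(2)] AB(1) assms(2) ab_groups_group \<open>Ord \<beta>\<close> by simp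
  finally show "ppow p B' \<beta> \<inter> carrier A' \<subseteq> ppow p A' \<beta>"
    by simp
qed (use assms in auto)

lemma isotype_partial_order: "Ord \<alpha> \<Longrightarrow> partial_order_on ab_groups (isotype p \<alpha>)"
  unfolding partial_order_on_def preorder_on_def
proof (intro conjI)
  assume "Ord \<alpha>"
  show "isotype p \<alpha> \<subseteq> ab_groups \<times> ab_groups"
    by (auto simp: isotype_def)
  show "refl_on ab_groups (isotype p \<alpha>)"
    by (rule refl_onI, rule isotypeI)
      (use is_subgroup_refl ab_groups_group ppow_carrier Ord_upto[OF \<open>Ord \<alpha>\<close>] \<open>Ord \<alpha>\<close> in blast)+
  show "antisym (isotype p \<alpha>)"
  proof (rule antisymI)
    fix A B
    assume AB: "(A, B) \<in> isotype p \<alpha>" and BA: "(B, A) \<in> isotype p \<alpha>"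
    show "A = B"
      by (rule is_subgroup_antisym[OF isotypeD(1,2,3)[OF AB] isotypeD(3)[OF BA]])
  qed
  show "trans (isotype p \<alpha>)"
  proof (rule transI)
    fix A B C
    assume AB: "(A, B) \<in> isotype p \<alpha>" and BC: "(B, C) \<in> isotype p \<alpha>"
    show "(A, C) \<in> isotype p \<alpha>"
    proof (rule isotypeI)
      show "is_subgroup A C"
        using is_subgroup_trans[OF _ _ isotypeD(3)[OF AB] isotypeD(3)[OF BC]] isotypeD(1)[OF AB]
          isotypeD(2)[OF BC] ab_groups_group by blast
      fix \<beta>
      assume \<beta>: "\<beta> \<in> insert \<alpha> (elts \<alpha>)"
      show "ppow p C \<beta> \<inter> carrier A \<subseteq> ppow p A \<beta>"
        using isotypeD(4)[OF AB \<beta>] isotypeD(4)[OF BC \<beta>] is_subgroup_carrier[OF isotypeD(3)[OF AB]] by blast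
    qed (use isotypeD(1)[OF AB] isotypeD(2)[OF BC] \<open>Ord \<alpha>\<close> in auto)
  qed
qed

lemma isotype_coherent:
  assumes AC: "(A, C) \<in> isotype p \<alpha>" and BC: "(B, C) \<in> isotype p \<alpha>" and "is_subgroup A B" "Ord \<alpha>"
  shows "(A, B) \<in> isotype p \<alpha>"
proof (rule isotypeI)
  fix \<beta>
  assume \<beta>: "\<beta> \<in> insert \<alpha> (elts \<alpha>)"
  show "ppow p B \<beta> \<inter> carrier A \<subseteq> ppow p A \<beta>"
    using isotypeD(4)[OF AC \<beta>] isotypeD(4)[OF BC \<beta>] by blast
qed (use assms isotypeD(1)[OF AC] isotypeD(1)[OF BC] in auto)

text \<open>
  The Loewenheim-Skolem cardinal is that of an infinite set at least as large as \<open>\<alpha>\<close>, because one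
  root has to be chosen for each ordinal below \<open>\<alpha>\<close>.
\<close>

lemma isotype_AEC:
  assumes "Ord \<alpha>"
  shows "AEC ab_groups (isotype p \<alpha>)"
proof -
  obtain x where x: "infinite (elts x)" "|elts \<alpha>| \<le>o |elts x|"
    using set_sized_infinite[OF set_sized_elts] by blast
  obtain \<kappa> where \<kappa>: "\<kappa> \<in> Card" "|elts \<kappa>| =o |elts x|"
    using ex_Card_ordIso by blast
  have "natLeq \<le>o |elts \<kappa>|"
    using x(1) ordIso_symmetric[OF \<kappa>(2)] infinite_iff_natLeq_ordLeq ordLeq_ordIso_trans by blast
  moreover have "|elts \<alpha>| \<le>o |elts \<kappa>|"
    using x(2) ordIso_symmetric[OF \<kappa>(2)] by (rule ordLeq_ordIso_trans)
  ultimately have LS: "\<exists>\<kappa> \<in> Card. natLeq \<le>o |elts \<kappa>| \<and>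
      (\<forall>B \<in> ab_groups. \<forall>X \<subseteq> carrier B. \<exists>A \<in> ab_groups.
         X \<subseteq> carrier A \<and> (A, B) \<in> isotype p \<alpha> \<and> |carrier A| \<le>o |X| +c |elts \<kappa>| )"
    using isotype_Loewenheim_Skolem[OF _ assms] \<kappa>(1) by blast
  have chains: "\<forall>\<delta> A. Limit \<delta> \<and> continuous_chain ab_groups (isotype p \<alpha>) \<delta> A \<longrightarrow>
      union_group (elts \<delta>) A \<in> ab_groups \<and>
      (\<forall>j \<in> elts \<delta>. (A j, union_group (elts \<delta>) A) \<in> isotype p \<alpha>) \<and>
      (\<forall>B \<in> ab_groups. (\<forall>i \<in> elts \<delta>. (A i, B) \<in> isotype p \<alpha>) \<longrightarrow> (union_group (elts \<delta>) A, B) \<in> isotype p \<alpha>)"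
    using isotype_union_chain[OF _ _ assms] by blast
  have iso: "\<forall>A B. \<forall>A' \<in> ab_groups. \<forall>B' \<in> ab_groups. \<forall>f.
      (A, B) \<in> isotype p \<alpha> \<and> f \<in> iso B B' \<and> f \<in> iso A A' \<longrightarrow> (A', B') \<in> isotype p \<alpha>"
    using isotype_closed_iso[OF _ _ _ _ _ assms] by blast
  have coherent: "\<forall>A B C. (A, C) \<in> isotype p \<alpha> \<and> (B, C) \<in> isotype p \<alpha> \<and> is_subgroup A B \<longrightarrow>
      (A, B) \<in> isotype p \<alpha>"
    using isotype_coherent[OF _ _ _ assms] by blast
  have po: "partial_order_on ab_groups (isotype p \<alpha>)"
    by (rule isotype_partial_order[OF assms])
  show ?thesis
    unfolding AEC_def
    by (intro conjI po iso chains coherent LS) (auto simp: isotype_def)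
qed

lemma isotype_L_Z: "Ord \<alpha> \<Longrightarrow> isotype p \<alpha> \<in> L_Z"
  unfolding L_Z_def using isotype_AEC direct_summand_isotype by blast

end

section \<open>Groups with a prescribed filtration by heights\<close>

lemma complex_root_exists:
  fixes z :: complex
  assumes "n > 0"
  shows "\<exists>w. w ^ n = z"
proof
  show "rcis (root n (cmod z)) (Arg z / n) ^ n = z"
    using assms by (simp add: DeMoivre2 rcis_cmod_Arg)
qed

lemma nontrivial_root_of_unity:
  assumes "n > 1"
  obtains \<zeta> :: complex where "\<zeta> ^ n = 1" "\<zeta> \<noteq> 1"
proof -
  have "card {z :: complex. z ^ n = 1} = n"
    using assms by (intro card_roots_unity_eq) simp
  then have "\<not> {z :: complex. z ^ n = 1} \<subseteq> {1}"
    using assms card_mono[of "{1 :: complex}" "{z. z ^ n = 1}"] by auto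
  then show ?thesis
    using that by blast
qed

lemma Prod_any_nonzero:
  fixes f :: "'b \<Rightarrow> 'c :: field"
  assumes "\<And>a. f a \<noteq> 0"
  shows "(\<Prod>a. f a) \<noteq> 0"
proof (cases "finite {a. f a \<noteq> 1}")
  case True
  then show ?thesis
    using assms by (simp add: Prod_any.expand_set)
qed simp

lemma Prod_any_power:
  fixes f :: "'b \<Rightarrow> 'c :: field"
  assumes "finite {a. f a \<noteq> 1}"
  shows "(\<Prod>a. f a) ^ n = (\<Prod>a. f a ^ n)"
proof -
  have "{a. f a ^ n \<noteq> 1} \<subseteq> {a. f a \<noteq> 1}"
    by auto
  then show ?thesis
    using Prod_any.expand_superset[OF assms, of "\<lambda>a. f a ^ n"]
    by (simp add: Prod_any.expand_set[of f] prod_power_distrib)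
qed

context zfc_universe
begin

text \<open>
  Nodes of the tree of decreasing sequences are lists with the most recent entry first, so that
  \<open>\<gamma> # t\<close> is a child of \<open>t\<close>.
\<close>

definition rank :: "'v \<Rightarrow> 'v list \<Rightarrow> 'v" where
  "rank \<alpha> t = (case t of [] \<Rightarrow> \<alpha> | \<gamma> # _ \<Rightarrow> \<gamma>)"

lemma rank_simps [simp]: "rank \<alpha> [] = \<alpha>" "rank \<alpha> (\<gamma> # t) = \<gamma>"
  by (simp_all add: rank_def)

primrec descending :: "'v \<Rightarrow> 'v list \<Rightarrow> bool" where
  "descending \<alpha> [] \<longleftrightarrow> True"
| "descending \<alpha> (\<gamma> # t) \<longleftrightarrow> \<gamma> \<in> elts (rank \<alpha> t) \<and> descending \<alpha> t"

text \<open>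
  The coordinate description of the simply presented \<open>p\<close>-group on the tree. The product ranges over
  all \<open>\<gamma>\<close> and not only over those below the rank of \<open>t\<close>; the support condition makes the other
  factors equal to 1, and in return the equation does not depend on \<open>\<alpha>\<close>. This is why the groups for
  different \<open>\<alpha>\<close> are nested. The complex numbers serve as a divisible group with elements of order \<open>p\<close>.
\<close>

definition tree_group :: "nat \<Rightarrow> 'v \<Rightarrow> ('v list \<Rightarrow> complex) set" where
  "tree_group p \<alpha> = {g. finite {t. g t \<noteq> 1} \<and> (\<forall>t. g t \<noteq> 1 \<longrightarrow> descending \<alpha> t) \<and>
     (\<forall>t. g t \<noteq> 0) \<and> (\<forall>t. g t ^ p = (\<Prod>\<gamma>. g (\<gamma> # t)))}"

text \<open>The coordinate form of \<open>p\<^sup>\<beta>\<close> of the tree group, as \<open>ppow_tree_monoid\<close> will show.\<close>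

definition height_part :: "nat \<Rightarrow> 'v \<Rightarrow> 'v \<Rightarrow> ('v list \<Rightarrow> complex) set" where
  "height_part p \<alpha> \<beta> = {g \<in> tree_group p \<alpha>. \<forall>t. rank \<alpha> t \<in> elts \<beta> \<longrightarrow> g t = 1}"

lemma tree_groupD:
  assumes "g \<in> tree_group p \<alpha>"
  shows "finite {t. g t \<noteq> 1}" "\<And>t. g t \<noteq> 1 \<Longrightarrow> descending \<alpha> t" "\<And>t. g t \<noteq> 0"
    "\<And>t. g t ^ p = (\<Prod>\<gamma>. g (\<gamma> # t))"
  using assms by (auto simp: tree_group_def)

lemma descending_rank:
  assumes "Ord \<alpha>" "descending \<alpha> t"
  shows "rank \<alpha> t \<in> insert \<alpha> (elts \<alpha>)"
  using assms(2) by (induction t) (use Ord_trans[OF assms(1)] in auto)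

lemma descending_lists:
  assumes "Ord \<alpha>" "descending \<alpha> t"
  shows "t \<in> lists (elts \<alpha>)"
  using assms(2)
proof (induction t)
  case (Cons \<gamma> t)
  then show ?case
    using descending_rank[OF assms(1), of t] Ord_trans[OF assms(1)] by auto
qed simp

lemma descending_mono:
  assumes "elts \<alpha> \<subseteq> elts \<alpha>'" "descending \<alpha> t"
  shows "descending \<alpha>' t"
  using assms(2) by (induction t) (use assms(1) in \<open>auto simp: rank_def split: list.splits\<close>)

lemma tree_group_mono: "elts \<alpha> \<subseteq> elts \<alpha>' \<Longrightarrow> tree_group p \<alpha> \<subseteq> tree_group p \<alpha>'"
  unfolding tree_group_def using descending_mono by blast

lemma finite_children:
  assumes "finite {t. g t \<noteq> 1}"
  shows "finite {\<gamma>. g (\<gamma> # t) \<noteq> 1}"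
proof -
  have "finite ((\<lambda>\<gamma>. \<gamma> # t) -` {t. g t \<noteq> 1})"
    using assms by (intro finite_vimageI) (auto simp: inj_def)
  then show ?thesis
    by (simp add: vimage_def)
qed

lemma tree_group_one: "(\<lambda>t. 1) \<in> tree_group p \<alpha>"
  by (simp add: tree_group_def)

lemma tree_group_mult:
  assumes "g \<in> tree_group p \<alpha>" "h \<in> tree_group p \<alpha>"
  shows "(\<lambda>t. g t * h t) \<in> tree_group p \<alpha>"
proof -
  note g = tree_groupD[OF assms(1)] and h = tree_groupD[OF assms(2)]
  have "{t. g t * h t \<noteq> 1} \<subseteq> {t. g t \<noteq> 1} \<union> {t. h t \<noteq> 1}"
    by auto
  then have "finite {t. g t * h t \<noteq> 1}"
    using g(1) h(1) by (rule finite_subset[OF _ finite_UnI])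
  moreover have "descending \<alpha> t" if "g t * h t \<noteq> 1" for t
    using that g(2)[of t] h(2)[of t] by (cases "g t = 1") auto
  moreover have "(g t * h t) ^ p = (\<Prod>\<gamma>. g (\<gamma> # t) * h (\<gamma> # t))" for t
    using g h Prod_any.distrib[OF finite_children[OF g(1)] finite_children[OF h(1)]]
    by (simp add: power_mult_distrib)
  ultimately show ?thesis
    using g(3) h(3) by (simp add: tree_group_def)
qed

lemma tree_group_inverse:
  assumes "g \<in> tree_group p \<alpha>"
  shows "(\<lambda>t. inverse (g t)) \<in> tree_group p \<alpha>"
proof -
  note g = tree_groupD[OF assms]
  have "inverse (g t) ^ p = (\<Prod>\<gamma>. inverse (g (\<gamma> # t)))" for t
  proof -
    have "finite {\<gamma>. inverse (g (\<gamma> # t)) \<noteq> 1}"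
      using finite_children[OF g(1)] by simp
    then have "(\<Prod>\<gamma>. g (\<gamma> # t)) * (\<Prod>\<gamma>. inverse (g (\<gamma> # t))) = (\<Prod>\<gamma>. g (\<gamma> # t) * inverse (g (\<gamma> # t)))"
      using Prod_any.distrib[OF finite_children[OF g(1)]] by simp
    also have "\<dots> = 1"
      using g(3) by simp
    finally show ?thesis
      using g(4)[of t] by (metis inverse_unique power_inverse)
  qed
  then show ?thesis
    using g by (simp add: tree_group_def)
qed

lemma tree_group_power: "g \<in> tree_group p \<alpha> \<Longrightarrow> (\<lambda>t. g t ^ n) \<in> tree_group p \<alpha>"
  by (induction n) (simp_all add: tree_group_one tree_group_mult)

text \<open>All children of the root carry the value 1, and their product is \<open>\<zeta>\<^sup>p\<close>.\<close>

lemma root_element: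
  assumes "\<zeta> ^ p = 1" "p > 0"
  shows "(\<lambda>t. if t = [] then \<zeta> else 1) \<in> tree_group p \<alpha>"
proof -
  have "\<zeta> \<noteq> 0"
    using assms by (auto simp: power_0_left)
  moreover have "finite {t :: 'v list. (if t = [] then \<zeta> else 1) \<noteq> 1}"
    by (rule finite_subset[of _ "{[]}"]) auto
  ultimately show ?thesis
    using assms by (auto simp: tree_group_def)
qed

lemma height_part_zero: "elts \<beta> = {} \<Longrightarrow> height_part p \<alpha> \<beta> = tree_group p \<alpha>"
  by (simp add: height_part_def)

text \<open>A node has rank below a limit ordinal \<open>\<beta>\<close> iff it has rank below some member of \<open>\<beta>\<close>.\<close>

lemma height_part_Limit:
  assumes "Limit \<beta>"
  shows "height_part p \<alpha> \<beta> = (\<Inter>\<gamma> \<in> elts \<beta>. height_part p \<alpha> \<gamma>)"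
proof
  show "height_part p \<alpha> \<beta> \<subseteq> (\<Inter>\<gamma> \<in> elts \<beta>. height_part p \<alpha> \<gamma>)"
    using Ord_trans[OF Limit_Ord[OF assms]] by (auto simp: height_part_def)
  show "(\<Inter>\<gamma> \<in> elts \<beta>. height_part p \<alpha> \<gamma>) \<subseteq> height_part p \<alpha> \<beta>"
  proof
    fix g
    assume g: "g \<in> (\<Inter>\<gamma> \<in> elts \<beta>. height_part p \<alpha> \<gamma>)"
    moreover have "elts \<beta> \<noteq> {}"
      using assms by (simp add: Limit_def)
    ultimately have "g \<in> tree_group p \<alpha>"
      by (auto simp: height_part_def)
    moreover have "g t = 1" if t: "rank \<alpha> t \<in> elts \<beta>" for t
    proof -
      obtain \<sigma> where "is_succ_of \<sigma> (rank \<alpha> t)" "\<sigma> \<in> elts \<beta>"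
        using Limit_succ_mem[OF assms t] .
      then show ?thesis
        using g by (auto simp: height_part_def is_succ_of_def)
    qed
    ultimately show "g \<in> height_part p \<alpha> \<beta>"
      by (simp add: height_part_def)
  qed
qed

text \<open>The children of a node of rank at most \<open>\<beta>\<close> have rank below \<open>\<beta>\<close>, so the product over them is trivial.\<close>

lemma power_height_part:
  assumes "Ord \<beta>" "is_succ_of \<sigma> \<beta>" "g \<in> height_part p \<alpha> \<beta>"
  shows "(\<lambda>t. g t ^ p) \<in> height_part p \<alpha> \<sigma>"
proof -
  have g: "g \<in> tree_group p \<alpha>" and g1: "\<And>t. rank \<alpha> t \<in> elts \<beta> \<Longrightarrow> g t = 1"
    using assms(3) by (auto simp: height_part_def)
  have "g t ^ p = 1" if "rank \<alpha> t \<in> elts \<sigma>" for t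
  proof -
    have "g (\<gamma> # t) = 1" for \<gamma>
    proof (rule ccontr)
      assume "g (\<gamma> # t) \<noteq> 1"
      then have "\<gamma> \<in> elts (rank \<alpha> t)"
        using tree_groupD(2)[OF g] by fastforce
      then have "\<gamma> \<in> elts \<beta>"
        using that Ord_trans[OF assms(1)] assms(2) by (auto simp: is_succ_of_def)
      then show False
        using g1[of "\<gamma> # t"] \<open>g (\<gamma> # t) \<noteq> 1\<close> by simp
    qed
    then show ?thesis
      using tree_groupD(4)[OF g] by simp
  qed
  then show ?thesis
    using tree_group_power[OF g] by (simp add: height_part_def)
qed

text \<open>
  Let \<open>g\<close> be trivial at all nodes of rank at most \<open>\<beta>\<close>. A \<open>p\<close>-th root \<open>h\<close> of \<open>g\<close> in the group must have
  the product of its values at the children of \<open>t\<close> equal to \<open>h(t)\<^sup>p = g(t)\<close>. Take arbitrary \<open>p\<close>-th roots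
  of the values of \<open>g\<close> where these are nontrivial, which happens only at nodes of rank above \<open>\<beta>\<close>,
  and let the value at the child of \<open>t\<close> of rank exactly \<open>\<beta>\<close> correct the product. The correction is
  the quotient of \<open>g(t)\<close> by the product of the roots at the other children. Its \<open>p\<close>-th power is
  \<open>g(t)\<^sup>p\<close> divided by the product of the values of \<open>g\<close> at the children, hence 1, as it should be at a
  node where \<open>g\<close> is trivial.
\<close>

lemma height_part_root:
  assumes "p > 0" "Ord \<alpha>" "Ord \<beta>" "is_succ_of \<sigma> \<beta>" "g \<in> height_part p \<alpha> \<sigma>"
  shows "\<exists>h \<in> height_part p \<alpha> \<beta>. g = (\<lambda>t. h t ^ p)"
proof -
  have g: "g \<in> tree_group p \<alpha>" and g1: "\<And>t. rank \<alpha> t \<in> insert \<beta> (elts \<beta>) \<Longrightarrow> g t = 1"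
    using assms(4,5) by (auto simp: height_part_def is_succ_of_def)
  note gD = tree_groupD[OF g]
  \<comment> \<open>The root of 1 has to be 1 itself, so that the support stays finite and inside the tree.\<close>
  define k where "k t = (if g t = 1 then 1 else SOME w. w ^ p = g t)" for t
  have k_pow: "k t ^ p = g t" for t
    using someI_ex[OF complex_root_exists[OF assms(1), of "g t"]] by (simp add: k_def)
  have k1: "k t \<noteq> 1 \<longleftrightarrow> g t \<noteq> 1" for t
    using k_pow[of t] by (auto simp: k_def)
  have k0: "k t \<noteq> 0" for t
    using k_pow[of t] gD(3)[of t] assms(1) by (auto simp: power_0_left)
  have fin_k: "finite {t. k t \<noteq> 1}"
    using gD(1) by (simp add: k1)
  define P where "P t = (\<Prod>\<gamma>. k (\<gamma> # t))" for t
  have P0: "P t \<noteq> 0" for t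
    unfolding P_def using k0 by (rule Prod_any_nonzero)
  have P_pow: "P t ^ p = g t ^ p" for t
    unfolding P_def Prod_any_power[OF finite_children[OF fin_k]] k_pow gD(4) ..
  \<comment> \<open>This guarantees that the child at which the correction is placed belongs to the tree.\<close>
  have above: "\<beta> \<in> elts (rank \<alpha> t)" if "g t \<noteq> 1" for t
  proof -
    have "Ord (rank \<alpha> t)"
      by (rule Ord_upto[OF assms(2) descending_rank[OF assms(2) gD(2)[OF that]]])
    moreover have "rank \<alpha> t \<notin> insert \<beta> (elts \<beta>)"
      using g1 that by blast
    ultimately show ?thesis
      using Ord_linear[OF assms(3)] by blast
  qed
  define h where "h t = (case t of [] \<Rightarrow> k [] | \<gamma> # s \<Rightarrow> if \<gamma> = \<beta> then g s / P s else k t)" for t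
  have h_cases: "h t = k t \<or> (\<exists>s. t = \<beta> # s \<and> h t = g s / P s)" for t
    by (cases t) (auto simp: h_def)
  have h_pow: "h t ^ p = g t" for t
  proof -
    have "(g s / P s) ^ p = g (\<beta> # s)" for s
      using g1[of "\<beta> # s"] P_pow[of s] gD(3)[of s] by (simp add: power_divide)
    then show ?thesis
      using h_cases[of t] k_pow by auto
  qed
  have h_prod: "(\<Prod>\<gamma>. h (\<gamma> # t)) = g t" for t
  proof -
    have "(\<lambda>\<gamma>. h (\<gamma> # t)) = (\<lambda>\<gamma>. k (\<gamma> # t))(\<beta> := g t / P t)"
      by (auto simp: h_def fun_eq_iff)
    \<comment> \<open>The uncorrected value at the child of rank \<open>\<beta>\<close> contributes nothing to the product.\<close>
    moreover have "k (\<beta> # t) = 1"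
      using k1[of "\<beta> # t"] g1[of "\<beta> # t"] by simp
    ultimately have "(\<Prod>\<gamma>. h (\<gamma> # t)) = g t / P t * P t"
      unfolding P_def by (simp only: Prod_any.update[OF finite_children[OF fin_k]])
    then show ?thesis
      using P0 by simp
  qed
  have new: "g s \<noteq> 1 \<or> (\<exists>\<gamma>. g (\<gamma> # s) \<noteq> 1)" if "g s / P s \<noteq> 1" for s
  proof (rule ccontr)
    assume "\<not> ?thesis"
    then have "g s = 1" "\<And>\<gamma>. k (\<gamma> # s) = 1"
      using k1 by auto
    then show False
      using that by (simp add: P_def)
  qed
  have "{t. h t \<noteq> 1} \<subseteq> {t. g t \<noteq> 1} \<union> Cons \<beta> ` {t. g t \<noteq> 1} \<union> (Cons \<beta> \<circ> tl) ` {t. g t \<noteq> 1}"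
  proof
    fix t
    assume t: "t \<in> {t. h t \<noteq> 1}"
    show "t \<in> {t. g t \<noteq> 1} \<union> Cons \<beta> ` {t. g t \<noteq> 1} \<union> (Cons \<beta> \<circ> tl) ` {t. g t \<noteq> 1}"
    proof (cases "h t = k t")
      case True
      then show ?thesis
        using t k1 by simp
    next
      case False
      then obtain s where s: "t = \<beta> # s" "h t = g s / P s"
        using h_cases by blast
      then consider "g s \<noteq> 1" | \<gamma> where "g (\<gamma> # s) \<noteq> 1"
        using new t by auto
      then show ?thesis
        by cases (use s in \<open>auto intro!: image_eqI[of _ _ "_ # s"]\<close>)
    qed
  qed
  then have "finite {t. h t \<noteq> 1}"
    by (rule finite_subset) (intro finite_UnI finite_imageI gD(1))
  moreover have "descending \<alpha> t" if t: "h t \<noteq> 1" for t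
  proof (cases "h t = k t")
    case True
    then show ?thesis
      using t k1 gD(2) by simp
  next
    case False
    then obtain s where s: "t = \<beta> # s" "h t = g s / P s"
      using h_cases by blast
    then consider "g s \<noteq> 1" | \<gamma> where "g (\<gamma> # s) \<noteq> 1"
      using new t by auto
    then show ?thesis
    proof cases
      case 1
      then show ?thesis
        using above[OF 1] gD(2)[OF 1] s by simp
    next
      case 2
      have "descending \<alpha> s" "\<gamma> \<in> elts (rank \<alpha> s)" "\<beta> \<in> elts \<gamma>"
        using above[OF 2] gD(2)[OF 2] by simp_all
      moreover have "Ord (rank \<alpha> s)"
        by (rule Ord_upto[OF assms(2) descending_rank[OF assms(2) calculation(1)]])
      ultimately show ?thesis
        using s Ord_trans by simp
    qed
  qed
  moreover have "h t \<noteq> 0" for t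
    using h_cases[of t] k0 P0 gD(3) by auto
  ultimately have "h \<in> tree_group p \<alpha>"
    by (simp add: tree_group_def h_pow h_prod)
  moreover have "h t = 1" if "rank \<alpha> t \<in> elts \<beta>" for t
  proof -
    have "h t = k t"
      using h_cases[of t] that by auto
    then show ?thesis
      using g1[of t] that k1 by auto
  qed
  ultimately have "h \<in> height_part p \<alpha> \<beta>"
    by (simp add: height_part_def)
  then show ?thesis
    using h_pow by (intro bexI[of _ h]) auto
qed

lemma height_part_succ:
  assumes "p > 0" "Ord \<alpha>" "Ord \<beta>" "is_succ_of \<sigma> \<beta>"
  shows "height_part p \<alpha> \<sigma> = (\<lambda>g t. g t ^ p) ` height_part p \<alpha> \<beta>"
  using power_height_part[OF assms(3,4)] height_part_root[OF assms] by blast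

text \<open>No node of the tree has rank above \<open>\<alpha>\<close>, so the group has no nontrivial element of height \<open>\<alpha> + 1\<close>.\<close>

lemma height_part_trivial:
  assumes "Ord \<alpha>" "is_succ_of \<sigma> \<alpha>" "g \<in> height_part p \<alpha> \<sigma>"
  shows "g = (\<lambda>t. 1)"
proof
  fix t
  have g: "g \<in> tree_group p \<alpha>" "rank \<alpha> t \<in> elts \<sigma> \<Longrightarrow> g t = 1"
    using assms(3) by (auto simp: height_part_def)
  show "g t = 1"
    using tree_groupD(2)[OF g(1), of t] descending_rank[OF assms(1), of t] g(2) assms(2)
    by (auto simp: is_succ_of_def)
qed

text \<open>
  Coding real numbers by their lower cuts of rationals turns a function on the tree into a set of
  triples of a list over \<open>\<alpha>\<close>, a truth value (which selects the real or the imaginary part), and a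
  rational number.
\<close>

lemma set_sized_tree_group:
  assumes "Ord \<alpha>"
  shows "set_sized (tree_group p \<alpha>)"
proof (rule set_sized_inj_on)
  let ?cut = "\<lambda>g :: 'v list \<Rightarrow> complex. {(t, b, q :: rat). t \<in> lists (elts \<alpha>) \<and>
    of_rat q < (if b then Re (g t) else Im (g t))}"
  have le: "x \<le> y" if "\<And>q :: rat. of_rat q < x \<Longrightarrow> of_rat q < y" for x y :: real
    using that of_rat_dense[of y x] by (meson linorder_not_le order_less_asym)
  have cut_le: "Re (g t) \<le> Re (h t) \<and> Im (g t) \<le> Im (h t)"
    if "?cut g = ?cut h" "t \<in> lists (elts \<alpha>)" for g h t
  proof -
    have cut: "(t, b, q) \<in> ?cut g \<longleftrightarrow> (t, b, q) \<in> ?cut h" for b q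
      using that(1) by simp
    show ?thesis
      using cut[of True] cut[of False] that(2) by (auto intro!: le)
  qed
  show "inj_on ?cut (tree_group p \<alpha>)"
  proof (rule inj_onI, rule ext)
    fix g h t
    assume g: "g \<in> tree_group p \<alpha>" and h: "h \<in> tree_group p \<alpha>" and eq: "?cut g = ?cut h"
    show "g t = h t"
    proof (cases "t \<in> lists (elts \<alpha>)")
      case True
      then show ?thesis
        using cut_le[OF eq] cut_le[OF eq[symmetric]] by (simp add: complex_eq_iff order_antisym)
    next
      case False
      then have "\<not> descending \<alpha> t"
        using descending_lists[OF assms] by blast
      then show ?thesis
        using tree_groupD(2)[OF g] tree_groupD(2)[OF h] by metis
    qed
  qed
  show "?cut ` tree_group p \<alpha> \<subseteq> Pow (lists (elts \<alpha>) \<times> UNIV)"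
    by auto
  show "set_sized (Pow (lists (elts \<alpha>) \<times> (UNIV :: (bool \<times> rat) set)))"
    by (rule set_sized_Pow[OF set_sized_Times[OF set_sized_lists[OF set_sized_elts] set_sized_countable]])
qed

text \<open>
  The transport of the tree group into the universe along an injection \<open>e\<close>. The same \<open>e\<close> can be used
  for different \<open>\<alpha>\<close>, which keeps the copies nested.
\<close>

definition tree_monoid :: "nat \<Rightarrow> 'v \<Rightarrow> (('v list \<Rightarrow> complex) \<Rightarrow> 'v) \<Rightarrow> 'v monoid" where
  "tree_monoid p \<alpha> e = \<lparr>carrier = e ` tree_group p \<alpha>,
     monoid.mult = (\<lambda>x y. if x \<in> e ` tree_group p \<alpha> \<and> y \<in> e ` tree_group p \<alpha>
       then e (\<lambda>t. inv_into (tree_group p \<alpha>) e x t * inv_into (tree_group p \<alpha>) e y t) else undefined),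
     one = e (\<lambda>t. 1)\<rparr>"

lemma carrier_tree_monoid [simp]: "carrier (tree_monoid p \<alpha> e) = e ` tree_group p \<alpha>"
  and one_tree_monoid [simp]: "\<one>\<^bsub>tree_monoid p \<alpha> e\<^esub> = e (\<lambda>t. 1)"
  by (simp_all add: tree_monoid_def)

lemma mult_tree_monoid:
  assumes "inj_on e (tree_group p \<alpha>)" "g \<in> tree_group p \<alpha>" "h \<in> tree_group p \<alpha>"
  shows "e g \<otimes>\<^bsub>tree_monoid p \<alpha> e\<^esub> e h = e (\<lambda>t. g t * h t)"
  using assms by (simp add: tree_monoid_def)

lemma pow_tree_monoid:
  assumes "inj_on e (tree_group p \<alpha>)" "g \<in> tree_group p \<alpha>"
  shows "e g [^]\<^bsub>tree_monoid p \<alpha> e\<^esub> (n :: nat) = e (\<lambda>t. g t ^ n)"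
  by (induction n) (use assms in \<open>simp_all add: mult_tree_monoid tree_group_power mult.commute\<close>)

lemma tree_monoid_ab_groups:
  assumes "inj_on e (tree_group p \<alpha>)" "Ord \<alpha>"
  shows "tree_monoid p \<alpha> e \<in> ab_groups"
proof -
  have "comm_group (tree_monoid p \<alpha> e)"
  proof (rule comm_groupI)
    fix x
    assume "x \<in> carrier (tree_monoid p \<alpha> e)"
    then obtain g where g: "g \<in> tree_group p \<alpha>" "x = e g"
      by auto
    then have "e (\<lambda>t. inverse (g t)) \<otimes>\<^bsub>tree_monoid p \<alpha> e\<^esub> x = e (\<lambda>t. inverse (g t) * g t)"
      using mult_tree_monoid[OF assms(1) tree_group_inverse] by simp
    also have "\<dots> = \<one>\<^bsub>tree_monoid p \<alpha> e\<^esub>"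
      using tree_groupD(3)[OF g(1)] by simp
    finally show "\<exists>y \<in> carrier (tree_monoid p \<alpha> e). y \<otimes>\<^bsub>tree_monoid p \<alpha> e\<^esub> x = \<one>\<^bsub>tree_monoid p \<alpha> e\<^esub>"
      using tree_group_inverse[OF g(1)] by (intro bexI[of _ "e (\<lambda>t. inverse (g t))"]) auto
  qed (auto simp: mult_tree_monoid[OF assms(1)] tree_group_mult tree_group_one ac_simps)
  moreover have "carrier (tree_monoid p \<alpha> e) \<in> range elts"
    by (rule set_sized_image_is_set[OF set_sized_tree_group[OF assms(2)], of e p]) auto
  ultimately show ?thesis
    by (auto simp: ab_groups_def extensional_def tree_monoid_def)
qed

lemma ppow_tree_monoid:
  assumes "p > 0" "inj_on e (tree_group p \<alpha>)" "Ord \<alpha>" "Ord \<beta>"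
  shows "ppow p (tree_monoid p \<alpha> e) \<beta> = e ` height_part p \<alpha> \<beta>"
  using assms(4)
proof (induction rule: Ord_induct)
  case (zero \<beta>)
  then show ?case
    by (simp add: ppow_zero height_part_zero)
next
  case (succ \<beta> \<gamma>)
  have "e g [^]\<^bsub>tree_monoid p \<alpha> e\<^esub> p = e (\<lambda>t. g t ^ p)" if "g \<in> height_part p \<alpha> \<gamma>" for g
    using that by (intro pow_tree_monoid assms) (simp add: height_part_def)
  then show ?case
    by (simp add: ppow_succ[OF succ.hyps(2)] succ.IH image_image
        height_part_succ[OF assms(1,3) succ.hyps])
next
  case (limit \<beta>)
  obtain \<gamma> where \<gamma>: "\<gamma> \<in> elts \<beta>"
    using limit.hyps by (auto simp: Limit_def)
  have "height_part p \<alpha> \<gamma> \<subseteq> tree_group p \<alpha>" for \<gamma>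
    by (auto simp: height_part_def)
  then have "e ` (\<Inter>\<gamma> \<in> elts \<beta>. height_part p \<alpha> \<gamma>) = (\<Inter>\<gamma> \<in> elts \<beta>. e ` height_part p \<alpha> \<gamma>)"
    using assms(2) \<gamma> by (intro image_INT[where j = \<gamma>]) auto
  then show ?case
    using limit by (simp add: ppow_Limit height_part_Limit)
qed

section \<open>Strictness and the size of the chain\<close>

text \<open>
  The smaller group lives on the larger tree with everything removed that starts with \<open>\<theta>\<close>. Cutting
  off this branch lowers the rank of the root by one and changes no other rank.
\<close>

lemma isotype_not_succ:
  assumes "p > 1" "Ord \<theta>" "is_succ_of \<sigma> \<theta>"
  obtains A B where "(A, B) \<in> isotype p \<theta>" "ppow p B \<sigma> \<inter> carrier A \<noteq> ppow p A \<sigma>"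
proof -
  have "Ord \<sigma>"
    using ex_succ[OF assms(2)] assms(3) extensionality unfolding is_succ_of_def by metis
  have p: "p > 0"
    using assms(1) by simp
  obtain x and e :: "('v list \<Rightarrow> complex) \<Rightarrow> 'v" where e: "inj_on e (tree_group p \<sigma>)" "e ` tree_group p \<sigma> \<subseteq> elts x"
    using set_sized_tree_group[OF \<open>Ord \<sigma>\<close>] unfolding set_sized_def card_of_ordLeq[symmetric] by blast
  have sub: "tree_group p \<theta> \<subseteq> tree_group p \<sigma>"
    using assms(3) by (intro tree_group_mono) (auto simp: is_succ_of_def)
  have e': "inj_on e (tree_group p \<theta>)"
    using e(1) sub by (rule inj_on_subset)
  let ?A = "tree_monoid p \<theta> e" and ?B = "tree_monoid p \<sigma> e"
  note A = tree_monoid_ab_groups[OF e' \<open>Ord \<theta>\<close>] and B = tree_monoid_ab_groups[OF e(1) \<open>Ord \<sigma>\<close>]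
  have ppow_Int: "ppow p ?B \<beta> \<inter> carrier ?A = e ` (height_part p \<sigma> \<beta> \<inter> tree_group p \<theta>)" if "Ord \<beta>" for \<beta>
    using inj_on_image_Int[OF e(1) _ sub, of "height_part p \<sigma> \<beta>"]
    by (simp add: ppow_tree_monoid[OF p e(1) \<open>Ord \<sigma>\<close> that] height_part_def)
  have "(?A, ?B) \<in> isotype p \<theta>"
  proof (rule isotypeI[OF A B _ \<open>Ord \<theta>\<close>])
    show "is_subgroup ?A ?B"
    proof (rule is_subgroupI)
      show "carrier ?A \<subseteq> carrier ?B"
        using sub by auto
      show "y \<otimes>\<^bsub>?A\<^esub> z = y \<otimes>\<^bsub>?B\<^esub> z" if "y \<in> carrier ?A" "z \<in> carrier ?A" for y z
        using that by (auto simp: mult_tree_monoid[OF e(1)] mult_tree_monoid[OF e'] subsetD[OF sub])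
    qed (use A B ab_groups_group in auto)
    fix \<beta>
    assume \<beta>: "\<beta> \<in> insert \<theta> (elts \<theta>)"
    then have "Ord \<beta>"
      by (rule Ord_upto[OF \<open>Ord \<theta>\<close>])
    have "\<theta> \<notin> elts \<beta>"
      using \<beta> mem_asym by auto
    \<comment> \<open>The two trees assign different ranks only to the root, and neither of these is below \<open>\<beta>\<close>.\<close>
    have "height_part p \<sigma> \<beta> \<inter> tree_group p \<theta> \<subseteq> height_part p \<theta> \<beta>"
    proof
      fix g
      assume g: "g \<in> height_part p \<sigma> \<beta> \<inter> tree_group p \<theta>"
      have "g t = 1" if "rank \<theta> t \<in> elts \<beta>" for t
        using g that \<open>\<theta> \<notin> elts \<beta>\<close> by (cases t) (auto simp: height_part_def)
      then show "g \<in> height_part p \<theta> \<beta>"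
        using g by (simp add: height_part_def)
    qed
    then show "ppow p ?B \<beta> \<inter> carrier ?A \<subseteq> ppow p ?A \<beta>"
      unfolding ppow_Int[OF \<open>Ord \<beta>\<close>] ppow_tree_monoid[OF p e' \<open>Ord \<theta>\<close> \<open>Ord \<beta>\<close>] by blast
  qed
  moreover have "ppow p ?B \<sigma> \<inter> carrier ?A \<noteq> ppow p ?A \<sigma>"
  proof
    obtain \<zeta> :: complex where \<zeta>: "\<zeta> ^ p = 1" "\<zeta> \<noteq> 1"
      using nontrivial_root_of_unity[OF assms(1)] .
    \<comment> \<open>The root has rank \<open>\<sigma>\<close> in the larger tree, so this element has height \<open>\<sigma>\<close> there.\<close>
    let ?g = "\<lambda>t :: 'v list. if t = [] then \<zeta> else 1"
    have g: "?g \<in> tree_group p \<alpha>" for \<alpha>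
      by (rule root_element[OF \<zeta>(1) p])
    then have "?g \<in> height_part p \<sigma> \<sigma> \<inter> tree_group p \<theta>"
      by (auto simp: height_part_def)
    moreover assume "ppow p ?B \<sigma> \<inter> carrier ?A = ppow p ?A \<sigma>"
    ultimately have "e ?g \<in> e ` height_part p \<theta> \<sigma>"
      unfolding ppow_Int[OF \<open>Ord \<sigma>\<close>] ppow_tree_monoid[OF p e' \<open>Ord \<theta>\<close> \<open>Ord \<sigma>\<close>] by blast
    then have "e ?g = e (\<lambda>t. 1)"
      using height_part_trivial[OF \<open>Ord \<theta>\<close> assms(3)] by blast
    then have "?g = (\<lambda>t. 1)"
      using inj_onD[OF e' _ g tree_group_one] by blast
    then show False
      using \<zeta>(2) by (metis (full_types))
  qed
  ultimately show ?thesis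
    by (rule that)
qed

lemma isotype_strict:
  assumes "p > 1" "Ord \<theta>'" "\<theta> \<in> elts \<theta>'"
  shows "L_less (isotype p \<theta>) (isotype p \<theta>')"
proof -
  have "insert \<theta> (elts \<theta>) \<subseteq> insert \<theta>' (elts \<theta>')"
    using assms(3) Ord_trans[OF assms(2)] by blast
  then have "isotype p \<theta>' \<subseteq> isotype p \<theta>"
    unfolding isotype_def by auto
  moreover have "isotype p \<theta> \<noteq> isotype p \<theta>'"
  proof -
    have "Ord \<theta>"
      using assms(2,3) by (rule Ord_mem)
    then obtain \<sigma> where \<sigma>: "is_succ_of \<sigma> \<theta>"
      by (rule ex_succ)
    obtain A B where "(A, B) \<in> isotype p \<theta>" "ppow p B \<sigma> \<inter> carrier A \<noteq> ppow p A \<sigma>"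
      by (rule isotype_not_succ[OF assms(1) \<open>Ord \<theta>\<close> \<sigma>])
    then show ?thesis
      using isotypeD(4)[OF _ succ_le[OF assms(2,3) \<sigma>]] by blast
  qed
  ultimately show ?thesis
    by (simp add: L_less_def L_le_def)
qed

lemma isotype_inj_on_Ord: "p > 1 \<Longrightarrow> inj_on (isotype p) {\<alpha>. Ord \<alpha>}"
proof (rule inj_onI)
  fix \<alpha> \<beta>
  assume "p > 1" "\<alpha> \<in> {\<alpha>. Ord \<alpha>}" "\<beta> \<in> {\<alpha>. Ord \<alpha>}" "isotype p \<alpha> = isotype p \<beta>"
  then show "\<alpha> = \<beta>"
    using Ord_linear[of \<alpha> \<beta>] isotype_strict[of p \<alpha> \<beta>] isotype_strict[of p \<beta> \<alpha>] by (auto simp: L_less_def)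
qed

lemma proper_class_isotype: "p > 1 \<Longrightarrow> proper_class_sized (isotype p ` Card)"
  using set_sized_inj_on[OF inj_on_subset[OF isotype_inj_on_Ord] order_refl] proper_class_Card Card_Ord by blast

lemma chain_isotype:
  assumes "p > 1" "\<And>\<alpha>. \<alpha> \<in> S \<Longrightarrow> Ord \<alpha>"
  shows "Complete_Partial_Order.chain L_le (isotype p ` S)"
proof (rule chainI)
  fix R S'
  assume "R \<in> isotype p ` S" "S' \<in> isotype p ` S"
  then obtain \<alpha> \<beta> where "\<alpha> \<in> S" "\<beta> \<in> S" and RS: "R = isotype p \<alpha>" "S' = isotype p \<beta>"
    by blast
  then have "Ord \<alpha>" "Ord \<beta>"
    using assms(2) by blast+
  then show "L_le R S' \<or> L_le S' R"
    using Ord_linear[of \<alpha> \<beta>] isotype_strict[OF assms(1), of \<beta> \<alpha>] isotype_strict[OF assms(1), of \<alpha> \<beta>]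
    by (auto simp: RS L_less_def L_le_def)
qed

end

theorem theorem5p13:
  fixes elts :: "'v \<Rightarrow> 'v set"
  assumes "zfc_universe elts"
  shows "zfc_universe.proper_class_sized elts (zfc_universe.L_Z elts) \<and>
    (\<forall>p::nat. Factorial_Ring.prime p \<longrightarrow>
       (\<forall>\<theta> \<in> zfc_universe.Card elts. zfc_universe.isotype elts p \<theta> \<in> zfc_universe.L_Z elts) \<and>
       (\<forall>\<theta> \<in> zfc_universe.Card elts. \<forall>\<theta>' \<in> zfc_universe.Card elts. \<theta> \<in> elts \<theta>' \<longrightarrow>
          zfc_universe.L_less (zfc_universe.isotype elts p \<theta>) (zfc_universe.isotype elts p \<theta>')) \<and>
       Complete_Partial_Order.chain zfc_universe.L_le
         (zfc_universe.isotype elts p ` zfc_universe.Card elts) \<and>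
       zfc_universe.proper_class_sized elts
         (zfc_universe.isotype elts p ` zfc_universe.Card elts))"
proof -
  interpret zfc_universe elts
    by (rule assms)
  have mem: "isotype p \<theta> \<in> L_Z" if "\<theta> \<in> Card" for p :: nat and \<theta>
    using isotype_L_Z Card_Ord that by blast
  have "proper_class_sized L_Z"
    using proper_class_isotype[of 2] set_sized_subset[of L_Z "isotype 2 ` Card"] mem by auto
  moreover have "L_less (isotype p \<theta>) (isotype p \<theta>')"
    if "Factorial_Ring.prime p" "\<theta>' \<in> Card" "\<theta> \<in> elts \<theta>'" for p :: nat and \<theta> \<theta>'
    using isotype_strict[OF prime_gt_1_nat Card_Ord] that by blast
  moreover have "Complete_Partial_Order.chain L_le (isotype p ` Card)"
    if "Factorial_Ring.prime p" for p :: nat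
    using chain_isotype[OF prime_gt_1_nat[OF that] Card_Ord] .
  moreover have "proper_class_sized (isotype p ` Card)" if "Factorial_Ring.prime p" for p :: nat
    using proper_class_isotype[OF prime_gt_1_nat[OF that]] .
  ultimately show ?thesis
    using mem by blast
qed

end
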